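(* Let $A$ be a $C^\ast$-algebra. Then $A$ is weakly Hahn-Banach smooth if and only if $A$ has the weak Namioka-Phelps property.
   Context: For a Banach space $X$, let $S_X$ be its unit sphere and $X^\ast$ its dual. A functional $x^\ast\in S_{X^\ast}$ is norm-attaining if $x^\ast(x)=1$ for some $x\in S_X$. Weakly Hahn-Banach smooth: $X$ has this property if every norm-attaining functional $x^\ast\in S_{X^\ast}$ is a point of weak$^\ast$-weak continuity for the identity map on $S_{X^\ast}$; that is, the identity map from $S_{X^\ast}$ with the weak$^\ast$ topology $\sigma(X^\ast,X)$ to $S_{X^\ast}$ with the weak topology $\sigma(X^\ast,X^{\ast\ast})$ is continuous at $x^\ast$. Weak Namioka-Phelps property: $X$ has this property if every norm-attaining functional $x^\ast \in S_{X^\ast}$ is a point of weak$^\ast$-norm continuity for the identity map on $S_{X^\ast}$; that is, the identity map from $S_{X^\ast}$ with the weak$^\ast$ topology to $S_{X^\ast}$ with the norm topology is continuous at $x^\ast$. *)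

theory Defs
  imports "HOL-Analysis.Analysis"
begin

section \<open>Complex normed spaces and C*-algebras\<close>

class complex_vector = real_vector +
  fixes scaleC :: "complex \<Rightarrow> 'a \<Rightarrow> 'a"  (infixr \<open>*\<^sub>C\<close> 75)
  assumes scaleC_add_right: "c *\<^sub>C (x + y) = c *\<^sub>C x + c *\<^sub>C y"
    and scaleC_add_left: "(c + d) *\<^sub>C x = c *\<^sub>C x + d *\<^sub>C x"
    and scaleC_scaleC: "c *\<^sub>C d *\<^sub>C x = (c * d) *\<^sub>C x"
    and scaleC_one: "1 *\<^sub>C x = x"
    and scaleC_of_real: "complex_of_real r *\<^sub>C x = r *\<^sub>R x"

class complex_normed_vector = complex_vector + real_normed_vector +
  assumes norm_scaleC: "norm (c *\<^sub>C x) = cmod c * norm x"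

text \<open>
  C*-algebras are not assumed to be unital: the library class \<^class>\<open>real_normed_algebra\<close> contains
  submultiplicativity of the norm, but no unit.
\<close>

class cstar_algebra = complex_normed_vector + banach + real_normed_algebra +
  fixes cstar :: "'a \<Rightarrow> 'a"  (\<open>_\<^sup>\<star>\<close> [1000] 999)
  assumes mult_scaleC_left: "(c *\<^sub>C x) * y = c *\<^sub>C (x * y)"
    and mult_scaleC_right: "x * (c *\<^sub>C y) = c *\<^sub>C (x * y)"
    and cstar_add: "(x + y)\<^sup>\<star> = x\<^sup>\<star> + y\<^sup>\<star>"
    and cstar_scaleC: "(c *\<^sub>C x)\<^sup>\<star> = cnj c *\<^sub>C x\<^sup>\<star>"
    and cstar_mult: "(x * y)\<^sup>\<star> = y\<^sup>\<star> * x\<^sup>\<star>"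
    and cstar_cstar: "(x\<^sup>\<star>)\<^sup>\<star> = x"
    and cstar_identity: "norm (x\<^sup>\<star> * x) = (norm x)\<^sup>2"

instantiation complex :: cstar_algebra
begin

definition scaleC_complex :: "complex \<Rightarrow> complex \<Rightarrow> complex"
  where "scaleC_complex c x = c * x"

definition cstar_complex :: "complex \<Rightarrow> complex"
  where "cstar_complex x = cnj x"

instance
  by standard
    (auto simp: scaleC_complex_def cstar_complex_def algebra_simps scaleR_conv_of_real
      norm_mult power2_eq_square)

end


section \<open>The dual of a complex normed space\<close>

typedef (overloaded) 'a cdual =
  "{f :: 'a::complex_normed_vector \<Rightarrow> complex.
      bounded_linear f \<and> (\<forall>c x. f (c *\<^sub>C x) = c * f x)}"
  morphisms cdual_apply Abs_cdual
  by (rule exI[of _ "\<lambda>_. 0"]) simp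

setup_lifting type_definition_cdual

lemma bounded_linear_cdual_apply: "bounded_linear (cdual_apply f)"
  using cdual_apply[of f] by simp

lemma cdual_apply_scaleC: "cdual_apply f (c *\<^sub>C x) = c * cdual_apply f x"
  using cdual_apply[of f] by simp

lemma cdual_eqI: "(\<And>x. cdual_apply f x = cdual_apply g x) \<Longrightarrow> f = g"
  by (metis cdual_apply_inject ext)

instantiation cdual :: (complex_normed_vector) complex_normed_vector
begin

lift_definition zero_cdual :: "'a cdual" is "\<lambda>_. 0"
  by simp

lift_definition plus_cdual :: "'a cdual \<Rightarrow> 'a cdual \<Rightarrow> 'a cdual" is "\<lambda>f g x. f x + g x"
  by (auto intro: bounded_linear_add simp: algebra_simps)

lift_definition uminus_cdual :: "'a cdual \<Rightarrow> 'a cdual" is "\<lambda>f x. - f x"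
  by (auto intro: bounded_linear_minus)

lift_definition minus_cdual :: "'a cdual \<Rightarrow> 'a cdual \<Rightarrow> 'a cdual" is "\<lambda>f g x. f x - g x"
  by (auto intro: bounded_linear_sub simp: algebra_simps)

lift_definition scaleR_cdual :: "real \<Rightarrow> 'a cdual \<Rightarrow> 'a cdual" is "\<lambda>r f x. r *\<^sub>R f x"
  by (auto intro: bounded_linear_const_scaleR)

lift_definition scaleC_cdual :: "complex \<Rightarrow> 'a cdual \<Rightarrow> 'a cdual" is "\<lambda>c f x. c * f x"
  by (auto intro: bounded_linear_const_mult)

lift_definition norm_cdual :: "'a cdual \<Rightarrow> real" is onorm .

definition dist_cdual :: "'a cdual \<Rightarrow> 'a cdual \<Rightarrow> real"
  where "dist_cdual f g = norm (f - g)"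

definition sgn_cdual :: "'a cdual \<Rightarrow> 'a cdual"
  where "sgn_cdual f = inverse (norm f) *\<^sub>R f"

definition [code del]:
  "(uniformity :: ('a cdual \<times> 'a cdual) filter) = (INF e\<in>{0 <..}. principal {(f, g). dist f g < e})"

definition open_cdual :: "'a cdual set \<Rightarrow> bool"
  where [code del]:
    "open_cdual S = (\<forall>f\<in>S. \<forall>\<^sub>F (f', g) in uniformity. f' = f \<longrightarrow> g \<in> S)"

instance
proof
  fix f g :: "'a cdual" and r :: real and c :: complex
  show "dist f g = norm (f - g)"
    by (rule dist_cdual_def)
  show "norm f = 0 \<longleftrightarrow> f = 0"
    by transfer (auto simp: onorm_eq_0)
  show "norm (f + g) \<le> norm f + norm g"
    by transfer (auto intro: onorm_triangle)
  show "norm (r *\<^sub>R f) = \<bar>r\<bar> * norm f"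
    by transfer (auto intro: onorm_scaleR)
  show "norm (c *\<^sub>C f) = cmod c * norm f"
  proof -
    have le: "norm (d *\<^sub>C h) \<le> cmod d * norm h" for d and h :: "'a cdual"
    proof transfer
      fix d :: complex and h :: "'a \<Rightarrow> complex"
      assume "bounded_linear h \<and> (\<forall>c x. h (c *\<^sub>C x) = c * h x)"
      then have h: "bounded_linear h" by simp
      show "onorm (\<lambda>x. d * h x) \<le> cmod d * onorm h"
      proof (rule onorm_bound)
        show "0 \<le> cmod d * onorm h"
          by (simp add: onorm_pos_le[OF h])
        show "cmod (d * h x) \<le> cmod d * onorm h * norm x" for x
          using mult_left_mono[OF onorm[OF h, of x] norm_ge_zero[of d]]
          by (simp add: norm_mult mult.assoc)
      qed
    qed
    show ?thesis
    proof (cases "c = 0")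
      case True
      then have "c *\<^sub>C f = 0" by transfer simp
      with True le[of c f] show ?thesis
        by (transfer) (simp add: onorm_zero)
    next
      case False
      then have "f = inverse c *\<^sub>C c *\<^sub>C f"
        by transfer (simp add: fun_eq_iff)
      then have "norm f \<le> cmod (inverse c) * norm (c *\<^sub>C f)"
        by (metis le)
      then have "cmod c * norm f \<le> norm (c *\<^sub>C f)"
        using False by (simp add: norm_divide field_simps)
      with le[of c f] show ?thesis by simp
    qed
  qed
qed (simp_all add: sgn_cdual_def uniformity_cdual_def open_cdual_def,
     (transfer, simp add: fun_eq_iff algebra_simps scaleR_conv_of_real)+)

end


section \<open>Weak and weak* topologies\<close>

definition weak_topology :: "'a::complex_normed_vector topology"
  where "weak_topology =
    topology_generated_by {{x. cdual_apply \<phi> x \<in> U} | \<phi> U. open U}"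

definition weak_star_topology :: "'a::complex_normed_vector cdual topology"
  where "weak_star_topology =
    topology_generated_by {{f. cdual_apply f x \<in> U} | x U. open U}"

definition norm_attaining :: "'a::complex_normed_vector cdual \<Rightarrow> bool"
  where "norm_attaining f \<longleftrightarrow> (\<exists>x. norm x = 1 \<and> cdual_apply f x = 1)"


section \<open>The two smoothness properties\<close>

text \<open>
  At type \<^typ>\<open>'a cdual\<close>, \<^const>\<open>weak_topology\<close> is the topology generated by the bidual
  \<^typ>\<open>'a cdual cdual\<close>.  The norm topology is \<^const>\<open>euclidean\<close>, the one given by the type class.
\<close>

definition weakly_Hahn_Banach_smooth :: "'a::{complex_normed_vector, banach} itself \<Rightarrow> bool"
  where "weakly_Hahn_Banach_smooth _ \<longleftrightarrow>
    (\<forall>f \<in> sphere (0 :: 'a cdual) 1. norm_attaining f \<longrightarrow>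
      topcontinuous_at (subtopology weak_star_topology (sphere 0 1))
        (subtopology weak_topology (sphere 0 1)) id f)"

definition weak_Namioka_Phelps :: "'a::{complex_normed_vector, banach} itself \<Rightarrow> bool"
  where "weak_Namioka_Phelps _ \<longleftrightarrow>
    (\<forall>f \<in> sphere (0 :: 'a cdual) 1. norm_attaining f \<longrightarrow>
      topcontinuous_at (subtopology weak_star_topology (sphere 0 1))
        (subtopology euclidean (sphere 0 1)) id f)"

end

theory Submission
  imports Defs
begin

text \<open>
  Weak Hahn-Banach smoothness forbids a double-limit configuration: unit functionals \<open>\<phi>\<^sub>k\<close> and
  contractions \<open>y\<^sub>n\<close> with \<open>\<phi>\<^sub>k(y\<^sub>n)\<close> tending to \<open>1\<close> in \<open>k\<close> and to \<open>0\<close> in \<open>n\<close>. Applied to Cesaro means of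
  powers, it shows that every contraction of the C*-algebra \<open>A\<close> is uniformly mean ergodic, which yields
  spectral projections in \<open>A\<close> without functional calculus. Applied to a decreasing sequence of projections,
  it shows that every projection is a finite sum of minimal ones, so every corner \<open>q A p\<close> is
  finite-dimensional. A norm-attaining functional of norm one lives on such a corner, unit functionals weak*
  close to it nearly do so, and on a finite-dimensional space weak* and norm convergence agree.
\<close>

section \<open>Functionals and the weak* topology\<close>

text \<open>A norm limit \<open>p\<close> of the means of \<open>b\<close> satisfies
  \<open>b * p = p * b = p\<close> and \<open>p * p = p\<close>; for self-adjoint \<open>b\<close>
  it is the spectral projection at 1. The obstacle is that \<open>p = 0\<close> need not push the
  norm below one: the means of the powers of -1 tend to 0. Hence only squares of self-adjoint
  elements are averaged, and for these a functional argument shows that null means force norm less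
  than one. It rests on the bound \<open>norm (2 *\<^sub>R (e * e * y) - y) \<le> norm y\<close> for
  self-adjoint contractions \<open>e\<close>, which does the work of positivity. As there may be no
  unit, factors such as 1 - p or 2 e^2 - 1 enter only through left or right multiplication by them.
  The passage from weak* to norm closeness is quantitative: adding an orthogonal element of norm
  \<open>l\<close> to a contraction raises the norm bound only by a term of order
  \<open>l^2\<close>, so a functional of norm at most 1 that is within \<open>l^2 / 2\<close> of 1
  at \<open>v\<close> has modulus at most \<open>l\<close> on every contraction orthogonal to
  \<open>v\<close> from one side.\<close>

lemma cdual_zero [simp]: "cdual_apply f 0 = 0"
  using bounded_linear_cdual_apply[of f] by (rule linear_simps)

lemma cdual_add: "cdual_apply f (x + y) = cdual_apply f x + cdual_apply f y"
  using bounded_linear_cdual_apply[of f] by (rule linear_simps)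

lemma cdual_diff: "cdual_apply f (x - y) = cdual_apply f x - cdual_apply f y"
  using bounded_linear_cdual_apply[of f] by (rule linear_simps)

lemma cdual_scaleR: "cdual_apply f (r *\<^sub>R x) = of_real r * cdual_apply f x"
  by (metis cdual_apply_scaleC scaleC_of_real)

lemma cdual_norm_bound: "cmod (cdual_apply f x) \<le> norm f * norm x"
  unfolding norm_cdual.rep_eq using onorm[OF bounded_linear_cdual_apply] .

lemma cdual_norm_le:
  assumes "norm f \<le> K" "norm x \<le> L"
  shows "cmod (cdual_apply f x) \<le> K * L"
  by (meson assms cdual_norm_bound mult_mono norm_ge_zero order_trans)

lemma cdual_norm_leI:
  assumes "0 \<le> K" "\<And>x. cmod (cdual_apply f x) \<le> K * norm x"
  shows "norm f \<le> K"
  unfolding norm_cdual.rep_eq using assms by (rule onorm_bound)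

lemma cdual_of_bounded:
  assumes add: "\<And>x y. F (x + y) = F x + F y"
    and scale: "\<And>c x. F (c *\<^sub>C x) = c * F x"
    and bound: "\<And>x. cmod (F x) \<le> K * norm x" and "0 \<le> K"
  obtains f where "cdual_apply f = F" "norm f \<le> K"
proof -
  have "bounded_linear F"
  proof (rule bounded_linear_intro[of _ K])
    show "F (r *\<^sub>R x) = r *\<^sub>R F x" for r x
      by (metis scale scaleC_of_real scaleR_conv_of_real)
    show "cmod (F x) \<le> norm x * K" for x
      using bound[of x] by (simp add: mult.commute)
  qed (rule add)
  then have eq: "cdual_apply (Abs_cdual F) = F"
    using scale by (intro Abs_cdual_inverse) simp
  show ?thesis
    by (rule that[OF eq cdual_norm_leI]) (simp_all add: eq bound assms)
qed

lemma unimodular_rotation: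
  obtains \<mu> where "cmod \<mu> = 1" "\<mu> * z = of_real (cmod z)"
proof (cases "z = 0")
  case True
  then show ?thesis using that[of 1] by simp
next
  case False
  have "cnj (sgn z) * z = of_real (cmod z)"
    using False complex_norm_square[of z]
    by (simp add: sgn_div_norm scaleR_conv_of_real power2_eq_square mult_ac) (simp add: field_simps)
  then show ?thesis using that[of "cnj (sgn z)"] False by (simp add: norm_sgn)
qed

section \<open>Hahn-Banach through minimal sublinear functionals\<close>

definition sublinear :: "('a::real_vector \<Rightarrow> real) \<Rightarrow> bool"
  where "sublinear p \<longleftrightarrow> (\<forall>x y. p (x + y) \<le> p x + p y) \<and> (\<forall>c\<ge>0. \<forall>x. p (c *\<^sub>R x) \<le> c * p x)"

lemma sublinear_add: "sublinear p \<Longrightarrow> p (x + y) \<le> p x + p y"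
  and sublinear_scale_le: "sublinear p \<Longrightarrow> 0 \<le> c \<Longrightarrow> p (c *\<^sub>R x) \<le> c * p x"
  by (auto simp: sublinear_def)

lemma sublinear_zero: "sublinear p \<Longrightarrow> p 0 = 0"
  using sublinear_add[of p 0 0] sublinear_scale_le[of p 0 0] by simp

text \<open>The inequality in the definition, applied to \<open>inverse c\<close> and
  \<open>c *\<^sub>R x\<close>, gives the reverse inequality. The one-sided form in the definition
  is the easier one to check for infima.\<close>

lemma sublinear_scale:
  assumes "sublinear p" "0 \<le> c"
  shows "p (c *\<^sub>R x) = c * p x"
proof (cases "c = 0")
  case False
  then have "p (inverse c *\<^sub>R c *\<^sub>R x) \<le> inverse c * p (c *\<^sub>R x)"
    using assms by (intro sublinear_scale_le) auto
  then have "c * p x \<le> p (c *\<^sub>R x)"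
    using False assms(2) by (simp add: field_simps)
  with sublinear_scale_le[OF assms] show ?thesis by (rule antisym)
qed (use sublinear_zero[OF assms(1)] in simp)

lemma sublinear_minus: "sublinear p \<Longrightarrow> - p (- x) \<le> p x"
  using sublinear_add[of p x "- x"] sublinear_zero[of p] by simp

text \<open>The largest sublinear functional below \<open>p\<close> that is linear along the line through \<open>v\<close>.\<close>

definition straighten :: "('a::real_vector \<Rightarrow> real) \<Rightarrow> 'a \<Rightarrow> 'a \<Rightarrow> real"
  where "straighten p v y = (INF t\<in>{0..}. p (y + t *\<^sub>R v) - t * p v)"

lemma straighten_le:
  assumes "sublinear p" "0 \<le> t"
  shows "straighten p v y \<le> p (y + t *\<^sub>R v) - t * p v"
proof -
  \<comment> \<open>Subadditivity for \<open>s *\<^sub>R v = - y + (y + s *\<^sub>R v)\<close>: the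
    infimum is over a set bounded below, so \<open>INF\<close> has its intended meaning.\<close>
  have "- p (- y) \<le> p (y + s *\<^sub>R v) - s * p v" if "0 \<le> s" for s
    using sublinear_add[OF assms(1), of "- y" "y + s *\<^sub>R v"] sublinear_scale[OF assms(1) that, of v]
    by simp
  then have "bdd_below ((\<lambda>t. p (y + t *\<^sub>R v) - t * p v) ` {0..})"
    by (intro bdd_belowI2[of _ "- p (- y)"]) auto
  then show ?thesis
    unfolding straighten_def using assms(2) by (intro cINF_lower) auto
qed

lemma straighten_greatest:
  assumes "\<And>t. 0 \<le> t \<Longrightarrow> K \<le> p (y + t *\<^sub>R v) - t * p v"
  shows "K \<le> straighten p v y"
  unfolding straighten_def using assms by (intro cINF_greatest) auto

lemma sublinear_straighten:
  assumes "sublinear p"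
  shows "sublinear (straighten p v)"
  unfolding sublinear_def
proof (intro conjI allI impI)
  fix x y
  \<comment> \<open>The shifts add: \<open>x + t *\<^sub>R v\<close> and
    \<open>y + u *\<^sub>R v\<close> sum to \<open>x + y\<close> shifted by
    \<open>t + u\<close>.\<close>
  have "straighten p v (x + y) - (p (y + u *\<^sub>R v) - u * p v) \<le> p (x + t *\<^sub>R v) - t * p v"
    if "0 \<le> t" "0 \<le> u" for t u
    using straighten_le[OF assms, of "t + u" v "x + y"] that
      sublinear_add[OF assms, of "x + t *\<^sub>R v" "y + u *\<^sub>R v"]
    by (simp add: algebra_simps)
  then have "straighten p v (x + y) - (p (y + u *\<^sub>R v) - u * p v) \<le> straighten p v x" if "0 \<le> u" for u
    using that by (intro straighten_greatest) auto
  then have "straighten p v (x + y) - straighten p v x \<le> straighten p v y"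
    by (intro straighten_greatest) (simp add: algebra_simps)
  then show "straighten p v (x + y) \<le> straighten p v x + straighten p v y"
    by simp
next
  fix c :: real and x
  assume c: "0 \<le> c"
  show "straighten p v (c *\<^sub>R x) \<le> c * straighten p v x"
  proof (cases "c = 0")
    case True
    then show ?thesis
      using straighten_le[OF assms, of 0 v 0] sublinear_zero[OF assms] by simp
  next
    case False
    have "straighten p v (c *\<^sub>R x) / c \<le> p (x + t *\<^sub>R v) - t * p v" if "0 \<le> t" for t
    proof -
      have "straighten p v (c *\<^sub>R x) \<le> p (c *\<^sub>R x + (c * t) *\<^sub>R v) - (c * t) * p v"
        using c that by (intro straighten_le[OF assms]) simp
      also have "\<dots> = c * (p (x + t *\<^sub>R v) - t * p v)"
        using sublinear_scale[OF assms c, of "x + t *\<^sub>R v"] by (simp add: algebra_simps)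
      finally show ?thesis
        using c False by (simp add: divide_le_eq mult.commute)
    qed
    then have "straighten p v (c *\<^sub>R x) / c \<le> straighten p v x"
      by (rule straighten_greatest)
    then show ?thesis
      using c False by (simp add: divide_le_eq mult.commute)
  qed
qed

text \<open>Straightening \<open>q\<close> along \<open>y\<close> cannot lower it, by minimality.
  The bound at \<open>t = 1\<close> then reads \<open>q x \<le> q (x + y) - q y\<close>, the missing
  half of additivity.\<close>

lemma minimal_sublinear_additive:
  assumes q: "sublinear q"
    and min: "\<And>r. sublinear r \<Longrightarrow> (\<And>x. r x \<le> q x) \<Longrightarrow> r = q"
  shows "q (x + y) = q x + q y"
proof -
  have "straighten q y = q"
    using straighten_le[OF q, of 0] by (intro min sublinear_straighten q) simp
  then have "q x \<le> q (x + y) - q y"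
    using straighten_le[OF q, of 1 y x] by simp
  then show ?thesis
    using sublinear_add[OF q, of x y] by simp
qed

text \<open>The common majorant \<open>p\<close> gives the lower bound \<open>- p (- x)\<close> at
  \<open>x\<close> for all members. Comparability serves subadditivity: for \<open>q\<close> at
  \<open>x\<close> and \<open>r\<close> at \<open>y\<close>, the smaller of the two functionals can
  be used at both points.\<close>

lemma sublinear_chain_INF:
  assumes "C \<noteq> {}"
    and chain: "\<And>q r. q \<in> C \<Longrightarrow> r \<in> C \<Longrightarrow> (\<forall>x. q x \<le> r x) \<or> (\<forall>x. r x \<le> q x)"
    and C: "\<And>q. q \<in> C \<Longrightarrow> sublinear q \<and> (\<forall>x. q x \<le> p x)"
  shows "sublinear (\<lambda>x. INF q\<in>C. q x)" and "\<And>q. q \<in> C \<Longrightarrow> (INF q\<in>C. q x) \<le> q x"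
proof -
  have "- p (- x) \<le> q x" if "q \<in> C" for q x
    using sublinear_minus[of q x] C[OF that] by (smt (verit))
  then have bdd: "bdd_below ((\<lambda>q. q x) ` C)" for x
    by (intro bdd_belowI2) auto
  then show le: "(INF q\<in>C. q x) \<le> q x" if "q \<in> C" for q x
    using that by (intro cINF_lower)
  show "sublinear (\<lambda>x. INF q\<in>C. q x)"
    unfolding sublinear_def
  proof (intro conjI allI impI)
    fix x y
    let ?I = "\<lambda>x. INF q\<in>C. q x"
    have "?I (x + y) \<le> q x + r y" if qr: "q \<in> C" "r \<in> C" for q r
    proof -
      have "?I (x + y) \<le> q x + q y" "?I (x + y) \<le> r x + r y"
        using le[OF qr(1), of "x + y"] le[OF qr(2), of "x + y"] C[OF qr(1)] C[OF qr(2)]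
          sublinear_add[of q x y] sublinear_add[of r x y] by auto
      then show ?thesis
        using chain[OF qr] by (smt (verit))
    qed
    then have "?I (x + y) - r y \<le> ?I x" if "r \<in> C" for r
      using that assms(1) by (intro cINF_greatest) (auto simp: algebra_simps)
    then have "?I (x + y) - ?I x \<le> ?I y"
      using assms(1) by (intro cINF_greatest) (auto simp: algebra_simps)
    then show "?I (x + y) \<le> ?I x + ?I y" by simp
  next
    fix c :: real and x
    assume c: "0 \<le> c"
    let ?I = "\<lambda>x. INF q\<in>C. q x"
    obtain q0 where q0: "q0 \<in> C" using assms(1) by auto
    show "?I (c *\<^sub>R x) \<le> c * ?I x"
    proof (cases "c = 0")
      case True
      then show ?thesis
        using le[OF q0, of 0] sublinear_zero[of q0] C[OF q0] by simp
    next
      case False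
      have "?I (c *\<^sub>R x) / c \<le> q x" if "q \<in> C" for q
        using le[OF that, of "c *\<^sub>R x"] sublinear_scale[of q c x] C[OF that] c False
        by (simp add: divide_le_eq mult.commute)
      then have "?I (c *\<^sub>R x) / c \<le> ?I x"
        using assms(1) by (intro cINF_greatest)
      then show ?thesis
        using c False by (simp add: divide_le_eq mult.commute)
    qed
  qed
qed

text \<open>Hahn-Banach with no subspace to extend from: Zorn yields a minimal sublinear functional
  below \<open>p\<close>, which is linear. A prescribed value at a vector is arranged by
  straightening \<open>p\<close> beforehand.\<close>

lemma sublinear_dominates_linear:
  assumes p: "sublinear p"
  obtains f where "\<And>x y. f (x + y) = f x + f y" "\<And>r x. f (r *\<^sub>R x) = r * f x" "\<And>x. f x \<le> p x"
proof -
  define A where "A = {q. sublinear q \<and> (\<forall>x. q x \<le> p x)}"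
  \<comment> \<open>The pointwise order reversed, so that the upper bounds demanded by Zorn are
    infima of chains.\<close>
  define P where "P q r \<longleftrightarrow> (\<forall>x. r x \<le> q x)" for q r :: "'a \<Rightarrow> real"
  have po: "partial_order_on A (relation_of P A)"
    by (intro partial_order_on_relation_ofI) (auto simp: P_def fun_eq_iff intro: order_trans antisym)
  have "\<exists>u\<in>A. \<forall>a\<in>C. P a u" if C: "C \<in> Chains (relation_of P A)" for C
  proof (cases "C = {}")
    case True
    then show ?thesis using p by (auto simp: A_def)
  next
    case False
    have sub: "sublinear q \<and> (\<forall>x. q x \<le> p x)" if "q \<in> C" for q
      using C that by (auto simp: Chains_def relation_of_def A_def)
    have ch: "(\<forall>x. q x \<le> r x) \<or> (\<forall>x. r x \<le> q x)" if "q \<in> C" "r \<in> C" for q r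
      using C that by (auto simp: Chains_def relation_of_def P_def)
    have sub_inf: "sublinear (\<lambda>x. INF q\<in>C. q x)"
      by (rule sublinear_chain_INF(1)[OF False]) (erule (1) ch, erule sub)
    have inf_le: "(INF q\<in>C. q x) \<le> q x" if "q \<in> C" for q x
      by (rule sublinear_chain_INF(2)[OF False _ _ that]) (erule (1) ch, erule sub)
    obtain q where q: "q \<in> C" using False by auto
    then have "(\<lambda>x. INF q\<in>C. q x) \<in> A"
      using sub_inf inf_le[OF q] sub[OF q] by (auto simp: A_def intro: order_trans)
    then show ?thesis
      using inf_le by (intro bexI[of _ "\<lambda>x. INF q\<in>C. q x"]) (auto simp: P_def)
  qed
  then have "\<exists>q\<in>A. \<forall>r\<in>A. P q r \<longrightarrow> r = q"
    by (rule predicate_Zorn[OF po])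
  then obtain q where q: "q \<in> A" and "\<forall>r\<in>A. P q r \<longrightarrow> r = q" ..
  then have qmin: "r = q" if "r \<in> A" "P q r" for r
    using that by simp
  have sq: "sublinear q" and le: "\<And>x. q x \<le> p x" using q by (auto simp: A_def)
  have add: "q (x + y) = q x + q y" for x y
  proof (rule minimal_sublinear_additive[OF sq])
    fix r assume "sublinear r" "\<And>x. r x \<le> q x"
    then show "r = q"
      using le by (intro qmin) (auto simp: A_def P_def intro: order_trans)
  qed
  have neg: "q (- x) = - q x" for x
    using add[of x "- x"] sublinear_zero[OF sq] by simp
  have "q (r *\<^sub>R x) = r * q x" for r x
  proof (cases "0 \<le> r")
    case False
    then have "q ((- r) *\<^sub>R x) = - r * q x"
      by (intro sublinear_scale[OF sq]) simp
    then show ?thesis using neg[of "r *\<^sub>R x"] by simp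
  qed (rule sublinear_scale[OF sq])
  with add le show ?thesis by (intro that)
qed

lemma sublinear_norm: "sublinear (norm :: 'a::real_normed_vector \<Rightarrow> real)"
  by (auto simp: sublinear_def norm_triangle_ineq)

text \<open>The norm is straightened at \<open>v\<close> to fix the value there, and
  \<open>F\<close> is the usual complexification \<open>r x - i r (i x)\<close> of the real
  functional. The conclusion is \<open>norm f \<le> 1\<close> rather than equality so that
  \<open>v = 0\<close> is covered even in the zero space.\<close>

theorem norming_functional:
  fixes v :: "'a::complex_normed_vector"
  obtains f where "norm f \<le> 1" "cdual_apply f v = norm v"
proof -
  obtain r :: "'a \<Rightarrow> real" where add: "\<And>x y. r (x + y) = r x + r y"
    and scale: "\<And>c x. r (c *\<^sub>R x) = c * r x"
    and le: "\<And>x. r x \<le> straighten norm v x"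
    using sublinear_dominates_linear[OF sublinear_straighten[OF sublinear_norm]] by metis
  have le_norm: "r x \<le> norm x" for x
    using le[of x] straighten_le[OF sublinear_norm, of 0 v x] by simp
  \<comment> \<open>At \<open>t = 1\<close> the shift by \<open>v\<close> cancels
    \<open>- v\<close>, leaving \<open>norm 0 - norm v\<close>.\<close>
  have "r (- v) \<le> - norm v"
    using le[of "- v"] straighten_le[OF sublinear_norm, of 1 v "- v"] by simp
  then have v: "r v = norm v"
    using scale[of "- 1" v] le_norm[of v] by simp
  define F where "F x = Complex (r x) (- r (\<i> *\<^sub>C x))" for x
  have ii: "\<i> *\<^sub>C \<i> *\<^sub>C x = (- 1) *\<^sub>R x" for x :: 'a
    by (metis scaleC_scaleC i_squared of_real_1 of_real_minus scaleC_of_real)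
  have split: "c *\<^sub>C x = Re c *\<^sub>R x + Im c *\<^sub>R (\<i> *\<^sub>C x)" for c and x :: 'a
    by (metis complex_eq mult.commute scaleC_add_left scaleC_of_real scaleC_scaleC)
  have Fadd: "F (x + y) = F x + F y" for x y
    by (simp add: F_def add scaleC_add_right complex_eq_iff)
  have iswap: "\<i> *\<^sub>C t *\<^sub>R x = t *\<^sub>R \<i> *\<^sub>C x" for t and x :: 'a
    by (metis mult.commute scaleC_of_real scaleC_scaleC)
  have Fscale: "F (c *\<^sub>C x) = c * F x" for c x
  proof -
    have "r (c *\<^sub>C x) = Re c * r x + Im c * r (\<i> *\<^sub>C x)"
      by (subst split) (simp add: add scale)
    moreover have "r (\<i> *\<^sub>C c *\<^sub>C x) = Re c * r (\<i> *\<^sub>C x) - Im c * r x"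
      using add[of "Re c *\<^sub>R \<i> *\<^sub>C x" "- (Im c *\<^sub>R x)"] scale[of "- Im c" x]
      by (subst split[of c x]) (simp add: scaleC_add_right scale iswap ii)
    ultimately show ?thesis
      by (simp add: F_def complex_eq_iff algebra_simps)
  qed
  have Fbound: "cmod (F x) \<le> norm x" for x
  proof -
    obtain c where c: "cmod c = 1" "c * F x = of_real (cmod (F x))"
      by (rule unimodular_rotation)
    then have "cmod (F x) = r (c *\<^sub>C x)"
      by (metis F_def Fscale Re_complex_of_real complex.sel(1))
    also have "\<dots> \<le> norm (c *\<^sub>C x)" by (rule le_norm)
    finally show ?thesis by (simp add: norm_scaleC c(1))
  qed
  obtain f where f: "cdual_apply f = F" "norm f \<le> 1"
    using cdual_of_bounded[of F 1, OF Fadd Fscale] Fbound by auto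
  have "Re (F v) = norm v" by (simp add: F_def v)
  moreover have "cmod (F v) \<le> norm v" by (rule Fbound)
  moreover have "(cmod (F v))\<^sup>2 = (Re (F v))\<^sup>2 + (Im (F v))\<^sup>2"
    by (rule cmod_power2)
  ultimately have "(norm v)\<^sup>2 + (Im (F v))\<^sup>2 \<le> (norm v)\<^sup>2"
    by (metis norm_ge_zero power_mono)
  then have "Im (F v) = 0" by simp
  with \<open>Re (F v) = norm v\<close> have "F v = norm v"
    by (simp add: complex_eq_iff)
  with f that show ?thesis by simp
qed

section \<open>Weak* compactness and cluster points\<close>

lemma weak_star_open_vimage:
  assumes "openin weak_star_topology V"
  obtains W where "open W" "V = {f. cdual_apply f \<in> W}"
proof -
  have "generate_topology_on {{f :: 'a cdual. cdual_apply f x \<in> U} | x U. open U} V"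
    using assms by (simp add: weak_star_topology_def openin_topology_generated_by_iff)
  then have "\<exists>W. open W \<and> V = {f. cdual_apply f \<in> W}"
  proof (induction rule: generate_topology_on.induct)
    case Empty
    then show ?case by (intro exI[of _ "{}"]) simp
  next
    case (Int a b)
    then obtain W W' where "open W" "open W'"
      "a = {f. cdual_apply f \<in> W}" "b = {f. cdual_apply f \<in> W'}" by auto
    then show ?case by (intro exI[of _ "W \<inter> W'"]) auto
  next
    case (UN K)
    then obtain g where "\<And>k. k \<in> K \<Longrightarrow> open (g k) \<and> k = {f. cdual_apply f \<in> g k}" by metis
    then show ?case by (intro exI[of _ "\<Union>(g ` K)"]) (auto; blast)
  next
    case (Basis s)
    then obtain x U where "s = {f. cdual_apply f x \<in> U}" "open U" by auto
    moreover have "open ((\<lambda>F :: 'a \<Rightarrow> complex. F x) -` U)"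
      by (intro open_vimage \<open>open U\<close> continuous_on_product_coordinates)
    ultimately show ?case by (intro exI) auto
  qed
  with that show ?thesis by auto
qed

lemma weak_star_openI: "open U \<Longrightarrow> openin weak_star_topology {f. cdual_apply f x \<in> U}"
  unfolding weak_star_topology_def openin_topology_generated_by_iff
  by (rule generate_topology_on.Basis) auto

lemma weak_openI: "open U \<Longrightarrow> openin weak_topology {x. cdual_apply f x \<in> U}"
  unfolding weak_topology_def openin_topology_generated_by_iff
  by (rule generate_topology_on.Basis) auto

lemma topspace_weak_star [simp]: "topspace (weak_star_topology :: 'a::complex_normed_vector cdual topology) = UNIV"
  using openin_subset[OF weak_star_openI[of UNIV]] by auto

lemma topspace_weak [simp]: "topspace (weak_topology :: 'a::complex_normed_vector topology) = UNIV"
  using openin_subset[OF weak_openI[of UNIV]] by auto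

lemma weak_open_imp_open:
  assumes "openin weak_topology V"
  shows "open V"
proof -
  have "generate_topology_on {{x. cdual_apply \<phi> x \<in> U} | \<phi> U. open U} V"
    using assms by (simp add: weak_topology_def openin_topology_generated_by_iff)
  then show ?thesis
  proof (induction rule: generate_topology_on.induct)
    case (Basis s)
    then obtain f U where "s = cdual_apply f -` U" "open U" by auto
    then show ?case
      using open_vimage linear_continuous_on[OF bounded_linear_cdual_apply] by metis
  qed auto
qed

text \<open>Banach-Alaoglu, stated for the underlying functions because the weak* topology is the
  trace of the product topology: the ball is the closed set of linear functions inside a product of
  discs, which is compact by Tychonoff.\<close>

lemma compact_dual_ball: "compact {F. \<exists>f :: 'a::complex_normed_vector cdual. norm f \<le> 1 \<and> cdual_apply f = F}"
proof -
  define B where "B = PiE UNIV (\<lambda>x :: 'a. cball 0 (norm x) :: complex set)"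
  define L where "L = (\<Inter>x. \<Inter>y. {F :: 'a \<Rightarrow> complex. F (x + y) = F x + F y}) \<inter>
    (\<Inter>c. \<Inter>x. {F. F (c *\<^sub>C x) = c * F x})"
  have "compactin (product_topology (\<lambda>x. euclidean) UNIV) B"
    unfolding B_def compactin_PiE by (simp add: compactin_euclidean_iff)
  then have "compact B"
    by (metis compactin_euclidean_iff euclidean_product_topology)
  moreover have "closed L"
    unfolding L_def
    by (intro closed_Int closed_INT ballI closed_Collect_eq continuous_intros
        continuous_on_product_coordinates)
  moreover have "{F. \<exists>f :: 'a cdual. norm f \<le> 1 \<and> cdual_apply f = F} = B \<inter> L"
  proof (intro set_eqI iffI)
    fix F assume "F \<in> {F. \<exists>f :: 'a cdual. norm f \<le> 1 \<and> cdual_apply f = F}"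
    then obtain f :: "'a cdual" where f: "norm f \<le> 1" "F = cdual_apply f" by auto
    then have "cmod (F x) \<le> norm x" for x
      using cdual_norm_le[of f 1 x] by simp
    then show "F \<in> B \<inter> L"
      by (auto simp: B_def L_def f cdual_add cdual_apply_scaleC)
  next
    fix F assume F: "F \<in> B \<inter> L"
    then have "cmod (F x) \<le> 1 * norm x" for x by (auto simp: B_def)
    then obtain f :: "'a cdual" where "cdual_apply f = F" "norm f \<le> 1"
      by (rule cdual_of_bounded[of F 1, rotated 2]) (use F in \<open>auto simp: L_def\<close>)
    then show "F \<in> {F. \<exists>f :: 'a cdual. norm f \<le> 1 \<and> cdual_apply f = F}" by blast
  qed
  ultimately show ?thesis by (simp add: compact_Int_closed)
qed

text \<open>Weak* compactness of the ball does not give convergent subsequences in general, so a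
  cluster point stands in for a limit. Values at single vectors are recovered wherever the scalar
  sequence converges.\<close>

lemma weak_star_cluster_point:
  fixes \<phi> :: "nat \<Rightarrow> 'a::complex_normed_vector cdual"
  assumes "\<And>n. norm (\<phi> n) \<le> 1"
  shows "\<exists>g. norm g \<le> 1 \<and>
    (\<forall>V. openin weak_star_topology V \<longrightarrow> g \<in> V \<longrightarrow> (\<exists>\<^sub>F n in sequentially. \<phi> n \<in> V))"
proof -
  let ?F = "filtermap (\<lambda>n. cdual_apply (\<phi> n)) sequentially"
  have "?F \<noteq> bot" by (simp add: filtermap_bot_iff)
  moreover have "eventually (\<lambda>F. F \<in> {F. \<exists>f :: 'a cdual. norm f \<le> 1 \<and> cdual_apply f = F}) ?F"
    unfolding eventually_filtermap using assms by (intro always_eventually) blast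
  ultimately obtain g :: "'a cdual" where g: "norm g \<le> 1" "inf (nhds (cdual_apply g)) ?F \<noteq> bot"
    using compact_dual_ball[where 'a = 'a] unfolding compact_filter by blast
  have "\<exists>\<^sub>F n in sequentially. \<phi> n \<in> V" if V: "openin weak_star_topology V" "g \<in> V" for V
  proof (rule ccontr)
    assume "\<not> (\<exists>\<^sub>F n in sequentially. \<phi> n \<in> V)"
    then have "\<forall>\<^sub>F n in sequentially. \<phi> n \<notin> V" by (simp add: not_frequently)
    moreover obtain W where W: "open W" "V = {f. cdual_apply f \<in> W}"
      using weak_star_open_vimage[OF V(1)] .
    ultimately have "eventually (\<lambda>F. F \<notin> W) ?F" by (simp add: eventually_filtermap)
    moreover have "eventually (\<lambda>F. F \<in> W) (nhds (cdual_apply g))"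
      using W V(2) by (intro eventually_nhds_in_open) auto
    ultimately have "eventually (\<lambda>F. False) (inf (nhds (cdual_apply g)) ?F)"
      unfolding eventually_inf by (intro exI[of _ "\<lambda>F. F \<in> W"] exI[of _ "\<lambda>F. F \<notin> W"]) simp
    with g(2) show False by (simp add: trivial_limit_def)
  qed
  with g(1) show ?thesis by blast
qed

lemma weak_star_cluster_value:
  assumes cluster: "\<And>V. openin weak_star_topology V \<Longrightarrow> g \<in> V \<Longrightarrow> \<exists>\<^sub>F n in sequentially. \<phi> n \<in> V"
    and lim: "(\<lambda>n. cdual_apply (\<phi> n) x) \<longlonglongrightarrow> c"
  shows "cdual_apply g x = c"
proof (rule ccontr)
  assume ne: "cdual_apply g x \<noteq> c"
  obtain U V where UV: "open U" "open V" "cdual_apply g x \<in> U" "c \<in> V" "U \<inter> V = {}"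
    using hausdorff[OF ne] by blast
  have "\<exists>\<^sub>F n in sequentially. \<phi> n \<in> {f. cdual_apply f x \<in> U}"
    using UV by (intro cluster weak_star_openI) auto
  moreover have "\<forall>\<^sub>F n in sequentially. cdual_apply (\<phi> n) x \<in> V"
    by (rule topological_tendstoD[OF lim UV(2,4)])
  ultimately have "\<exists>\<^sub>F n in sequentially. cdual_apply (\<phi> n) x \<in> V \<and> \<phi> n \<in> {f. cdual_apply f x \<in> U}"
    by (rule frequently_eventually_conj)
  with UV(5) show False by (auto dest!: frequently_ex)
qed

section \<open>Using and verifying the two smoothness properties\<close>

lemma evaluation_functional:
  fixes x :: "'a::complex_normed_vector"
  obtains \<Psi> :: "'a cdual cdual" where "norm \<Psi> \<le> norm x" "\<And>f. cdual_apply \<Psi> f = cdual_apply f x"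
proof -
  obtain \<Psi> :: "'a cdual cdual" where "cdual_apply \<Psi> = (\<lambda>f. cdual_apply f x)" "norm \<Psi> \<le> norm x"
  proof (rule cdual_of_bounded[of "\<lambda>f. cdual_apply f x" "norm x"])
    show "cmod (cdual_apply f x) \<le> norm x * norm f" for f
      using cdual_norm_bound[of f x] by (simp add: mult.commute)
  qed (auto simp: plus_cdual.rep_eq scaleC_cdual.rep_eq)
  then show ?thesis by (intro that) auto
qed

text \<open>The \<open>\<phi> k\<close> cluster weak* at a norm-attaining \<open>g\<close> with \<open>g (y n) = 1\<close> for all \<open>n\<close>, whereas a
  cluster point of \<open>y\<close> in the bidual separates \<open>g\<close> from all \<open>\<phi> k\<close>.\<close>

lemma smooth_double_limit:
  fixes y :: "nat \<Rightarrow> 'a::{complex_normed_vector, banach}"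
  assumes smooth: "weakly_Hahn_Banach_smooth TYPE('a)"
    and \<phi>: "\<And>k. norm (\<phi> k) \<le> 1" and y: "\<And>n. norm (y n) \<le> 1"
    and lim1: "\<And>n. (\<lambda>k. cdual_apply (\<phi> k) (y n)) \<longlonglongrightarrow> 1"
    and lim0: "\<And>k. (\<lambda>n. cdual_apply (\<phi> k) (y n)) \<longlonglongrightarrow> 0"
  shows False
proof -
  \<comment> \<open>The continuity hypothesis lives on the unit sphere, so the functionals are
    normalised; \<open>sgn\<close> is 0 only where \<open>\<phi> k = 0\<close>, which stops
    happening for large \<open>k\<close>.\<close>
  define \<theta> where "\<theta> k = sgn (\<phi> k)" for k
  have \<theta>: "cdual_apply (\<theta> k) x = of_real (inverse (norm (\<phi> k))) * cdual_apply (\<phi> k) x" for k x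
    by (simp add: \<theta>_def sgn_div_norm scaleR_cdual.rep_eq scaleR_conv_of_real)
  \<comment> \<open>The values at the single contraction \<open>y 0\<close> already tend to 1 and
    squeeze the norms from below.\<close>
  have norm1: "(\<lambda>k. norm (\<phi> k)) \<longlonglongrightarrow> 1"
  proof (rule tendsto_sandwich[of "\<lambda>k. cmod (cdual_apply (\<phi> k) (y 0))" _ _ "\<lambda>_. 1"])
    show "\<forall>\<^sub>F k in sequentially. cmod (cdual_apply (\<phi> k) (y 0)) \<le> norm (\<phi> k)"
      using cdual_norm_le[OF order_refl y[of 0]] by simp
    show "(\<lambda>k. cmod (cdual_apply (\<phi> k) (y 0))) \<longlonglongrightarrow> 1"
      using tendsto_norm[OF lim1[of 0]] by simp
  qed (use \<phi> in auto)
  have "\<forall>\<^sub>F k in sequentially. norm (\<phi> k) > 0"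
    using order_tendstoD(1)[OF norm1, of 0] by simp
  then have unit: "\<forall>\<^sub>F k in sequentially. norm (\<theta> k) = 1"
    by eventually_elim (simp add: \<theta>_def norm_sgn)
  have le1: "norm (\<theta> k) \<le> 1" for k by (simp add: \<theta>_def norm_sgn)
  from weak_star_cluster_point[of \<theta>, OF le1] obtain g where "norm g \<le> 1 \<and>
    (\<forall>V. openin weak_star_topology V \<longrightarrow> g \<in> V \<longrightarrow> (\<exists>\<^sub>F n in sequentially. \<theta> n \<in> V))" ..
  then have g: "norm g \<le> 1"
    "\<And>V. openin weak_star_topology V \<Longrightarrow> g \<in> V \<Longrightarrow> \<exists>\<^sub>F n in sequentially. \<theta> n \<in> V"
    by auto
  have "(\<lambda>k. cdual_apply (\<theta> k) (y n)) \<longlonglongrightarrow> of_real (inverse 1) * 1" for n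
    unfolding \<theta> by (intro tendsto_intros norm1 lim1) simp
  then have gy: "cdual_apply g (y n) = 1" for n
    using g(2) by (intro weak_star_cluster_value) auto
  then have "1 \<le> norm g * norm (y 0)"
    using cdual_norm_bound[of g "y 0"] by simp
  then have gn: "norm g = 1" "norm (y 0) = 1"
    using g(1) y[of 0] mult_left_le[of "norm (y 0)" "norm g"] mult_right_le_one_le[of "norm (y 0)" "norm g"]
    by (auto simp: mult.commute)
  have "\<exists>\<Psi> :: 'a cdual cdual. norm \<Psi> \<le> 1 \<and> (\<forall>f. cdual_apply \<Psi> f = cdual_apply f (y n))" for n
    using evaluation_functional[of "y n"] y[of n] by (metis order_trans)
  then obtain E :: "nat \<Rightarrow> 'a cdual cdual" where E: "\<And>n. norm (E n) \<le> 1"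
    "\<And>n f. cdual_apply (E n) f = cdual_apply f (y n)" by metis
  from weak_star_cluster_point[of E, OF E(1)] obtain \<Psi> where "norm \<Psi> \<le> 1 \<and>
    (\<forall>V. openin weak_star_topology V \<longrightarrow> \<Psi> \<in> V \<longrightarrow> (\<exists>\<^sub>F n in sequentially. E n \<in> V))" ..
  then have \<Psi>: "\<exists>\<^sub>F n in sequentially. E n \<in> V" if "openin weak_star_topology V" "\<Psi> \<in> V" for V
    using that by auto
  have \<Psi>g: "cdual_apply \<Psi> g = 1"
    by (rule weak_star_cluster_value[of \<Psi> E]) (erule (1) \<Psi>, simp add: E gy)
  have \<Psi>\<theta>: "cdual_apply \<Psi> (\<theta> k) = 0" for k
  proof (rule weak_star_cluster_value[of \<Psi> E])
    show "\<exists>\<^sub>F n in sequentially. E n \<in> V" if "openin weak_star_topology V" "\<Psi> \<in> V" for V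
      using that by (rule \<Psi>)
  next
    show "(\<lambda>n. cdual_apply (E n) (\<theta> k)) \<longlonglongrightarrow> 0"
      unfolding E \<theta> using tendsto_mult_right_zero[OF lim0[of k]] .
  qed
  have "norm_attaining g"
    using gn(2) gy[of 0] by (auto simp: norm_attaining_def)
  with smooth gn(1) have cont: "topcontinuous_at (subtopology weak_star_topology (sphere 0 1))
      (subtopology weak_topology (sphere 0 1)) id g"
    by (auto simp: weakly_Hahn_Banach_smooth_def)
  let ?W = "{f. cdual_apply \<Psi> f \<in> - {0}}"
  have "openin (subtopology weak_topology (sphere 0 1)) (sphere 0 1 \<inter> ?W)"
    by (intro openin_subtopology_Int2 weak_openI open_Compl) simp
  moreover have "id g \<in> sphere 0 1 \<inter> ?W" using gn \<Psi>g by simp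
  ultimately obtain U where U: "openin (subtopology weak_star_topology (sphere 0 1)) U"
    "g \<in> U" "\<And>f. f \<in> U \<Longrightarrow> id f \<in> sphere 0 1 \<inter> ?W"
    using cont unfolding topcontinuous_at_def by meson
  then obtain V where V: "openin weak_star_topology V" "U = V \<inter> sphere 0 1"
    unfolding openin_subtopology by blast
  then have "\<exists>\<^sub>F n in sequentially. norm (\<theta> n) = 1 \<and> \<theta> n \<in> V"
    using g(2) U(2) unit by (intro frequently_eventually_conj) auto
  then obtain n where "\<theta> n \<in> V" "norm (\<theta> n) = 1" by (auto dest!: frequently_ex)
  with U(3)[of "\<theta> n"] V(2) \<Psi>\<theta>[of n] show False by simp
qed

text \<open>This direction holds in every Banach space: weakly open sets are norm open, so only the
  target topology becomes coarser.\<close>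

lemma weak_Namioka_Phelps_imp_smooth:
  assumes "weak_Namioka_Phelps TYPE('a::{complex_normed_vector, banach})"
  shows "weakly_Hahn_Banach_smooth TYPE('a)"
  unfolding weakly_Hahn_Banach_smooth_def
proof (intro ballI impI)
  fix f :: "'a cdual" assume f: "f \<in> sphere 0 1" "norm_attaining f"
  have "openin (subtopology euclidean (sphere 0 1)) V"
    if "openin (subtopology weak_topology (sphere 0 1)) V" for V :: "'a cdual set"
    using that weak_open_imp_open unfolding openin_subtopology by (metis open_openin)
  then show "topcontinuous_at (subtopology weak_star_topology (sphere 0 1))
      (subtopology weak_topology (sphere 0 1)) id f"
    using assms f unfolding weak_Namioka_Phelps_def topcontinuous_at_def by auto
qed

lemma weak_Namioka_PhelpsI:
  assumes "\<And>(f :: 'a::{complex_normed_vector, banach} cdual) x e.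
      norm f = 1 \<Longrightarrow> norm x = 1 \<Longrightarrow> cdual_apply f x = 1 \<Longrightarrow> 0 < e \<Longrightarrow>
      \<exists>V. openin weak_star_topology V \<and> f \<in> V \<and> (\<forall>g\<in>V. norm g = 1 \<longrightarrow> norm (g - f) < e)"
  shows "weak_Namioka_Phelps TYPE('a)"
  unfolding weak_Namioka_Phelps_def
proof (intro ballI impI)
  fix f :: "'a cdual" assume f: "f \<in> sphere 0 1" "norm_attaining f"
  then obtain x where x: "norm x = 1" "cdual_apply f x = 1" by (auto simp: norm_attaining_def)
  show "topcontinuous_at (subtopology weak_star_topology (sphere 0 1))
      (subtopology euclidean (sphere 0 1)) id f"
    unfolding topcontinuous_at_def
  proof (intro conjI allI impI)
    fix W assume W: "openin (top_of_set (sphere 0 1)) W \<and> id f \<in> W"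
    then obtain e where e: "e > 0" "\<And>g. norm g = 1 \<Longrightarrow> dist g f < e \<Longrightarrow> g \<in> W"
      unfolding openin_euclidean_subtopology_iff by auto
    obtain V where V: "openin weak_star_topology V" "f \<in> V"
      "\<And>g. g \<in> V \<Longrightarrow> norm g = 1 \<Longrightarrow> norm (g - f) < e"
      using assms[of f x e] f x e by auto
    then have "openin (subtopology weak_star_topology (sphere 0 1)) (V \<inter> sphere 0 1)"
      by (auto simp: openin_subtopology)
    then show "\<exists>U. openin (subtopology weak_star_topology (sphere 0 1)) U \<and> f \<in> U \<and> (\<forall>g\<in>U. id g \<in> W)"
      using V f e by (intro exI[of _ "V \<inter> sphere 0 1"]) (auto simp: dist_norm)
  qed (use f in auto)
qed

section \<open>Elementary C*-algebra\<close>

lemma scaleC_zero_right [simp]: "c *\<^sub>C (0 :: 'a::complex_vector) = 0"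
  using scaleC_add_right[of c "0 :: 'a" 0] by simp

lemma scaleC_zero_left [simp]: "0 *\<^sub>C (x :: 'a::complex_vector) = 0"
  using scaleC_of_real[of 0 x] by simp

lemma scaleC_minus_left: "(- c) *\<^sub>C x = - (c *\<^sub>C (x :: 'a::complex_vector))"
  by (metis add.inverse_unique add.right_inverse scaleC_add_left scaleC_zero_left)

lemma scaleC_minus_right: "c *\<^sub>C (- x) = - (c *\<^sub>C (x :: 'a::complex_vector))"
  by (metis add.inverse_unique add.right_inverse scaleC_add_right scaleC_zero_right)

lemma scaleC_diff_right: "c *\<^sub>C (x - y) = c *\<^sub>C x - c *\<^sub>C (y :: 'a::complex_vector)"
  using scaleC_add_right[of c x "- y"] by (simp add: scaleC_minus_right)

lemma cstar_zero [simp]: "(0 :: 'a::cstar_algebra)\<^sup>\<star> = 0"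
  using cstar_add[of "0 :: 'a" 0] by simp

lemma cstar_minus: "(- x)\<^sup>\<star> = - ((x :: 'a::cstar_algebra)\<^sup>\<star>)"
  using cstar_add[of x "- x"] by (simp add: eq_neg_iff_add_eq_0 add.commute)

lemma cstar_diff: "(x - y)\<^sup>\<star> = (x :: 'a::cstar_algebra)\<^sup>\<star> - y\<^sup>\<star>"
  using cstar_add[of x "- y"] by (simp add: cstar_minus)

lemma cstar_scaleR: "(r *\<^sub>R x)\<^sup>\<star> = r *\<^sub>R (x :: 'a::cstar_algebra)\<^sup>\<star>"
  using cstar_scaleC[of "of_real r" x] by (simp add: scaleC_of_real)

lemma norm_cstar [simp]: "norm ((x :: 'a::cstar_algebra)\<^sup>\<star>) = norm x"
proof -
  have le: "norm y \<le> norm (y\<^sup>\<star>)" for y :: 'a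
  proof (cases "y = 0")
    case False
    have "norm y * norm y \<le> norm (y\<^sup>\<star>) * norm y"
      using norm_mult_ineq[of "y\<^sup>\<star>" y] by (simp add: cstar_identity power2_eq_square)
    with False show ?thesis by simp
  qed simp
  from le[of x] le[of "x\<^sup>\<star>"] show ?thesis by (simp add: cstar_cstar)
qed

lemma norm_mult_cstar: "norm (x * x\<^sup>\<star>) = (norm (x :: 'a::cstar_algebra))\<^sup>2"
  using cstar_identity[of "x\<^sup>\<star>"] by (simp add: cstar_cstar)

lemma norm_selfadjoint_square: "x\<^sup>\<star> = x \<Longrightarrow> norm (x * x) = (norm (x :: 'a::cstar_algebra))\<^sup>2"
  using cstar_identity[of x] by simp

lemma bounded_linear_cstar: "bounded_linear (cstar :: 'a::cstar_algebra \<Rightarrow> 'a)"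
  by (rule bounded_linear_intro[of _ 1]) (simp_all add: cstar_add cstar_scaleR)

lemmas tendsto_cstar = bounded_linear.tendsto[OF bounded_linear_cstar]

lemma norm_mult_le_of_le1:
  fixes x :: "'a::real_normed_algebra"
  assumes "norm x \<le> 1"
  shows "norm (x * y) \<le> norm y" "norm (y * x) \<le> norm y"
  using norm_mult_ineq[of x y] norm_mult_ineq[of y x] mult_right_mono[OF assms norm_ge_zero[of y]]
    mult_left_mono[OF assms norm_ge_zero[of y]]
  unfolding mult_1_left mult_1_right by linarith+

text \<open>\<open>pow_Suc x n\<close> is \<open>x\<close> to the power \<open>n + 1\<close>; the algebra need not contain a zeroth power.\<close>

primrec pow_Suc :: "'a::real_normed_algebra \<Rightarrow> nat \<Rightarrow> 'a"
  where "pow_Suc x 0 = x" | "pow_Suc x (Suc n) = x * pow_Suc x n"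

lemma pow_Suc_commute: "pow_Suc x n * x = x * pow_Suc x n"
  by (induction n) (simp_all add: mult.assoc)

lemma pow_Suc_add: "pow_Suc x m * pow_Suc x n = pow_Suc x (Suc (m + n))"
  by (induction m) (simp_all add: mult.assoc)

lemma norm_pow_Suc_le: "norm x \<le> 1 \<Longrightarrow> norm (pow_Suc x n) \<le> 1"
  by (induction n) (auto intro: order_trans[OF norm_mult_le_of_le1(1)])

lemma pow_Suc_selfadjoint: "x\<^sup>\<star> = x \<Longrightarrow> (pow_Suc x n)\<^sup>\<star> = pow_Suc (x :: 'a::cstar_algebra) n"
  by (induction n) (simp_all add: cstar_mult pow_Suc_commute)

text \<open>Repeated squaring with the C*-identity; the index \<open>2 ^ j - 1\<close> stands for
  the exponent \<open>2 ^ j\<close>.\<close>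

lemma norm_pow_Suc_selfadjoint:
  fixes x :: "'a::cstar_algebra"
  assumes "x\<^sup>\<star> = x"
  shows "norm (pow_Suc x (2 ^ j - 1)) = norm x ^ (2 ^ j)"
proof (induction j)
  case (Suc j)
  have "pow_Suc x (2 ^ Suc j - 1) = pow_Suc x (2 ^ j - 1) * pow_Suc x (2 ^ j - 1)"
  proof -
    obtain m where "(2 :: nat) ^ j = Suc m" using not0_implies_Suc[of "2 ^ j"] by auto
    then show ?thesis by (simp add: pow_Suc_add mult_2)
  qed
  then show ?case
    using Suc norm_selfadjoint_square[OF pow_Suc_selfadjoint[OF assms]]
    by (simp add: power_mult[symmetric] mult.commute)
qed simp

text \<open>The power with exponent \<open>2 ^ (n + 1)\<close> has norm 1 and contains the given
  power as a factor, the other factor being a contraction.\<close>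

lemma norm_pow_Suc_eq_1:
  fixes x :: "'a::cstar_algebra"
  assumes "x\<^sup>\<star> = x" "norm x = 1"
  shows "norm (pow_Suc x n) = 1"
proof (rule antisym)
  have "Suc n < 2 ^ Suc n" by (rule less_exp)
  then obtain k where k: "2 ^ Suc n - 1 = Suc (n + k)"
    by (metis Suc_diff_1 Suc_less_SucD add_Suc_right less_imp_Suc_add zero_less_numeral zero_less_power)
  have "1 = norm (pow_Suc x n * pow_Suc x k)"
    using norm_pow_Suc_selfadjoint[OF assms(1), of "Suc n"] assms(2) unfolding k pow_Suc_add by simp
  also have "\<dots> \<le> norm (pow_Suc x n)"
    using assms(2) by (intro norm_mult_le_of_le1 norm_pow_Suc_le) simp
  finally show "1 \<le> norm (pow_Suc x n)" .
qed (use assms(2) in \<open>simp add: norm_pow_Suc_le\<close>)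

text \<open>Mixed products vanish, so powers of \<open>a + b\<close> are sums of powers and stay
  below norm 2. A norm above 1 would make the powers with exponent \<open>2 ^ n\<close> grow without
  bound.\<close>

lemma norm_orthogonal_add_le_1:
  fixes a b :: "'a::cstar_algebra"
  assumes "a\<^sup>\<star> = a" "b\<^sup>\<star> = b" "a * b = 0" "norm a \<le> 1" "norm b \<le> 1"
  shows "norm (a + b) \<le> 1"
proof (rule ccontr)
  assume "\<not> norm (a + b) \<le> 1"
  then obtain n where n: "2 < norm (a + b) ^ n"
    using real_arch_pow[of "norm (a + b)" 2] by auto
  have ba: "b * a = 0"
    by (metis assms(1-3) cstar_mult cstar_zero)
  have "a * pow_Suc b m = 0" "b * pow_Suc a m = 0" for m
    by (induction m) (simp_all add: assms(3) ba flip: mult.assoc)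
  then have "pow_Suc (a + b) m = pow_Suc a m + pow_Suc b m" for m
    by (induction m) (simp_all add: algebra_simps)
  then have "norm (pow_Suc (a + b) m) \<le> 2" for m
    using norm_triangle_mono[OF norm_pow_Suc_le[OF assms(4), of m] norm_pow_Suc_le[OF assms(5), of m]]
    by simp
  then have "norm (a + b) ^ (2 ^ n) \<le> 2"
    using norm_pow_Suc_selfadjoint[of "a + b" n] assms(1,2) by (metis cstar_add)
  moreover have "norm (a + b) ^ n \<le> norm (a + b) ^ (2 ^ n)"
    using \<open>\<not> norm (a + b) \<le> 1\<close> less_exp[of n] by (intro power_increasing) auto
  ultimately show False using n by simp
qed

section \<open>Uniform mean ergodicity\<close>

definition ergodic_mean :: "'a::real_normed_algebra \<Rightarrow> nat \<Rightarrow> 'a"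
  where "ergodic_mean b n = inverse (real (Suc n)) *\<^sub>R (\<Sum>k\<le>n. pow_Suc b k)"

lemma norm_mean_le:
  fixes f :: "nat \<Rightarrow> 'a::real_normed_vector"
  assumes "\<And>k. k \<le> n \<Longrightarrow> norm (f k) \<le> K"
  shows "norm (inverse (real (Suc n)) *\<^sub>R (\<Sum>k\<le>n. f k)) \<le> K"
proof -
  have "norm (\<Sum>k\<le>n. f k) \<le> real (Suc n) * K"
    using sum_norm_bound[of "{..n}" f K] assms by simp
  then show ?thesis
    by (simp add: field_simps del: of_nat_Suc)
qed

lemma mean_const: "inverse (real (Suc n)) *\<^sub>R (\<Sum>k\<le>n. x) = (x :: 'a::real_vector)"
  by (simp add: sum_constant_scaleR del: of_nat_Suc)

lemma norm_ergodic_mean: "norm b \<le> 1 \<Longrightarrow> norm (ergodic_mean b n) \<le> 1"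
  unfolding ergodic_mean_def by (intro norm_mean_le norm_pow_Suc_le)

lemma ergodic_mean_0 [simp]: "ergodic_mean b 0 = b"
  by (simp add: ergodic_mean_def)

text \<open>The sum telescopes to the power of exponent \<open>k + 2\<close> minus \<open>b\<close>,
  a difference of two contractions.\<close>

lemma ergodic_mean_mult_diff:
  assumes "norm b \<le> 1"
  shows "norm (ergodic_mean b k * b - ergodic_mean b k) \<le> 2 * inverse (real (Suc k))"
proof -
  have "(\<Sum>j\<le>k. pow_Suc b j) * b - (\<Sum>j\<le>k. pow_Suc b j) = (\<Sum>j\<le>k. pow_Suc b (Suc j) - pow_Suc b j)"
    by (simp add: sum_distrib_right sum_subtractf pow_Suc_commute)
  also have "\<dots> = pow_Suc b (Suc k) - b"
    using sum_lessThan_telescope[of "pow_Suc b" "Suc k"] by (simp add: lessThan_Suc_atMost)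
  finally have eq: "ergodic_mean b k * b - ergodic_mean b k = inverse (real (Suc k)) *\<^sub>R (pow_Suc b (Suc k) - b)"
    by (simp add: ergodic_mean_def algebra_simps flip: scaleR_diff_right)
  have "norm (pow_Suc b (Suc k) - b) \<le> 2"
    using norm_triangle_ineq4[of "pow_Suc b (Suc k)" b] norm_pow_Suc_le[OF assms, of "Suc k"] assms
    by linarith
  then show ?thesis
    unfolding eq norm_scaleR
    using mult_left_mono[of "norm (pow_Suc b (Suc k) - b)" 2 "inverse (real (Suc k))"] by simp
qed

lemma ergodic_mean_pow_diff:
  assumes "norm b \<le> 1"
  shows "norm (ergodic_mean b k * pow_Suc b j - ergodic_mean b k)
    \<le> 2 * real (Suc j) * inverse (real (Suc k))"
proof (induction j)
  case 0
  show ?case using ergodic_mean_mult_diff[OF assms, of k] by simp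
next
  case (Suc j)
  let ?M = "ergodic_mean b k"
  have "?M * pow_Suc b (Suc j) - ?M = (?M * pow_Suc b j - ?M) * b + (?M * b - ?M)"
    by (simp add: algebra_simps flip: pow_Suc_commute)
  then have "norm (?M * pow_Suc b (Suc j) - ?M) \<le> norm ((?M * pow_Suc b j - ?M) * b) + norm (?M * b - ?M)"
    by (metis norm_triangle_ineq)
  also have "\<dots> \<le> 2 * real (Suc j) * inverse (real (Suc k)) + 2 * inverse (real (Suc k))"
    by (intro add_mono order_trans[OF norm_mult_le_of_le1(2) Suc] ergodic_mean_mult_diff assms)
  finally show ?case by (simp add: algebra_simps)
qed

text \<open>A mean of high index absorbs a fixed earlier one. With commutativity of the means, this
  single estimate supplies both iterated limits in the convergence proof below.\<close>

lemma ergodic_mean_mean_diff: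
  assumes "norm b \<le> 1"
  shows "norm (ergodic_mean b k * ergodic_mean b n - ergodic_mean b k)
    \<le> 2 * real (Suc n) * inverse (real (Suc k))"
proof -
  let ?M = "ergodic_mean b k"
  have "?M * ergodic_mean b n - ?M = inverse (real (Suc n)) *\<^sub>R (\<Sum>j\<le>n. ?M * pow_Suc b j - ?M)"
    unfolding sum_subtractf scaleR_diff_right mean_const
    by (simp add: ergodic_mean_def sum_distrib_left)
  moreover have "norm (?M * pow_Suc b j - ?M) \<le> 2 * real (Suc n) * inverse (real (Suc k))"
    if "j \<le> n" for j
    using that by (intro order_trans[OF ergodic_mean_pow_diff[OF assms]] mult_right_mono) auto
  ultimately show ?thesis by (metis norm_mean_le)
qed

lemma ergodic_mean_commute: "ergodic_mean b k * ergodic_mean b n = ergodic_mean b n * ergodic_mean b k"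
proof -
  have "(\<Sum>i\<le>k. pow_Suc b i) * (\<Sum>j\<le>n. pow_Suc b j) = (\<Sum>j\<le>n. pow_Suc b j) * (\<Sum>i\<le>k. pow_Suc b i)"
    unfolding sum_product by (subst sum.swap) (simp add: pow_Suc_add add.commute)
  then show ?thesis by (simp add: ergodic_mean_def)
qed

lemma tendsto_times_inverse_Suc: "(\<lambda>k. c * inverse (real (Suc k))) \<longlonglongrightarrow> 0"
  using tendsto_mult_right_zero[OF LIMSEQ_inverse_real_of_nat] .

text \<open>If the means \<open>?M\<close> are not Cauchy, there are differences \<open>D K\<close>
  of means with indices at least \<open>K\<close> and norm at least \<open>e\<close>. Norming
  functionals composed with left multiplication by \<open>D K\<close> and rescaled give
  \<open>\<phi> K\<close>. As \<open>K\<close> grows, \<open>D K * ?M N\<close> approaches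
  \<open>D K\<close>, so the value at \<open>?M N\<close> tends to 1; as \<open>N\<close> grows,
  \<open>?M N\<close> absorbs both means in \<open>D K\<close> and their difference cancels, so it
  tends to 0.\<close>

lemma smooth_ergodic_mean_convergent:
  fixes b :: "'a::cstar_algebra"
  assumes smooth: "weakly_Hahn_Banach_smooth TYPE('a)" and b: "norm b \<le> 1"
  shows "convergent (ergodic_mean b)"
proof (rule ccontr)
  let ?M = "ergodic_mean b"
  assume "\<not> convergent ?M"
  then obtain e where e: "e > 0" "\<And>K. \<exists>m\<ge>K. \<exists>n\<ge>K. e \<le> norm (?M m - ?M n)"
    unfolding Cauchy_convergent_iff[symmetric] Cauchy_iff by (meson not_le)
  then obtain m n where mn: "\<And>K. K \<le> m K" "\<And>K. K \<le> n K" "\<And>K. e \<le> norm (?M (m K) - ?M (n K))"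
    by metis
  define D where "D K = ?M (m K) - ?M (n K)" for K
  have De: "e \<le> norm (D K)" for K using mn by (simp add: D_def)
  have inv: "inverse (norm (D K)) \<le> inverse e" for K
    using De[of K] e(1) by (intro le_imp_inverse_le)
  have "\<exists>\<psi>. norm \<psi> \<le> 1 \<and> cdual_apply \<psi> (D K) = norm (D K)" for K
    using norming_functional by metis
  then obtain \<psi> where \<psi>: "\<And>K. norm (\<psi> K) \<le> 1" "\<And>K. cdual_apply (\<psi> K) (D K) = norm (D K)"
    by metis
  have \<psi>_le: "cmod (of_real (inverse (norm (D K))) * cdual_apply (\<psi> K) x) \<le> inverse e * norm x" for K x
    using mult_mono[OF inv[of K] cdual_norm_le[OF \<psi>(1)[of K] order_refl, of x]] e(1)
    by (simp add: norm_mult norm_inverse)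
  have "\<exists>\<phi>. norm \<phi> \<le> 1 \<and> (\<forall>y. cdual_apply \<phi> y = of_real (inverse (norm (D K))) * cdual_apply (\<psi> K) (D K * y))"
    for K
  proof -
    have "cmod (of_real (inverse (norm (D K))) * cdual_apply (\<psi> K) (D K * y)) \<le> 1 * norm y" for y
    proof -
      have "cmod (cdual_apply (\<psi> K) (D K * y)) \<le> norm (D K) * norm y"
        using cdual_norm_le[OF \<psi>(1)[of K] norm_mult_ineq] by simp
      moreover have "norm (D K) > 0" using De[of K] e(1) by linarith
      ultimately show ?thesis
        by (simp add: norm_mult norm_divide field_simps)
    qed
    then show ?thesis
      by (rule cdual_of_bounded[rotated 2])
        (auto simp: cdual_add cdual_apply_scaleC mult_scaleC_right distrib_left)
  qed
  then obtain \<phi> where \<phi>: "\<And>K. norm (\<phi> K) \<le> 1"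
    "\<And>K y. cdual_apply (\<phi> K) y = of_real (inverse (norm (D K))) * cdual_apply (\<psi> K) (D K * y)"
    by metis
  have "(\<lambda>K. cdual_apply (\<phi> K) (?M N)) \<longlonglongrightarrow> 1" for N
  proof (rule Lim_transform2[OF tendsto_const], rule Lim_null_comparison)
    show "(\<lambda>K. (inverse e * (4 * real (Suc N))) * inverse (real (Suc K))) \<longlonglongrightarrow> 0"
      by (rule tendsto_times_inverse_Suc)
    show "\<forall>\<^sub>F K in sequentially. norm (1 - cdual_apply (\<phi> K) (?M N))
        \<le> (inverse e * (4 * real (Suc N))) * inverse (real (Suc K))"
    proof (intro always_eventually allI)
      fix K
      have *: "norm (?M j * ?M N - ?M j) \<le> 2 * real (Suc N) * inverse (real (Suc K))" if "K \<le> j" for j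
        using that by (intro order_trans[OF ergodic_mean_mean_diff[OF b]] mult_left_mono le_imp_inverse_le) auto
      have "norm (D K * ?M N - D K) \<le> norm (?M (m K) * ?M N - ?M (m K)) + norm (?M (n K) * ?M N - ?M (n K))"
        using norm_triangle_ineq4[of "?M (m K) * ?M N - ?M (m K)" "?M (n K) * ?M N - ?M (n K)"]
        by (simp add: D_def algebra_simps)
      then have "norm (D K * ?M N - D K) \<le> 4 * real (Suc N) * inverse (real (Suc K))"
        using *[OF mn(1)[of K]] *[OF mn(2)[of K]] by linarith
      then have "inverse e * norm (D K * ?M N - D K) \<le> inverse e * (4 * real (Suc N) * inverse (real (Suc K)))"
        using e(1) by (intro mult_left_mono) auto
      moreover have "D K \<noteq> 0" using De[of K] e(1) by auto
      then have "cdual_apply (\<phi> K) (?M N) - 1 = of_real (inverse (norm (D K))) * cdual_apply (\<psi> K) (D K * ?M N - D K)"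
        by (simp add: \<phi>(2) \<psi>(2) cdual_diff right_diff_distrib)
      ultimately show "norm (1 - cdual_apply (\<phi> K) (?M N)) \<le> (inverse e * (4 * real (Suc N))) * inverse (real (Suc K))"
        using \<psi>_le[of K "D K * ?M N - D K"] by (simp only: norm_minus_commute[of 1] mult.assoc)
    qed
  qed
  moreover have "(\<lambda>N. cdual_apply (\<phi> K) (?M N)) \<longlonglongrightarrow> 0" for K
  proof -
    define C where "C = 2 * real (Suc (m K)) + 2 * real (Suc (n K))"
    have "norm (cdual_apply (\<phi> K) (?M N)) \<le> (inverse e * C) * inverse (real (Suc N))" for N
    proof -
      have "D K * ?M N = (?M N * ?M (m K) - ?M N) - (?M N * ?M (n K) - ?M N)"
        unfolding D_def left_diff_distrib ergodic_mean_commute[of b N] by simp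
      then have "norm (D K * ?M N) \<le> norm (?M N * ?M (m K) - ?M N) + norm (?M N * ?M (n K) - ?M N)"
        by (metis norm_triangle_ineq4)
      then have "norm (D K * ?M N) \<le> C * inverse (real (Suc N))"
        using ergodic_mean_mean_diff[OF b, of N "m K"] ergodic_mean_mean_diff[OF b, of N "n K"]
        unfolding C_def distrib_right by linarith
      then have "inverse e * norm (D K * ?M N) \<le> inverse e * (C * inverse (real (Suc N)))"
        using e(1) by (intro mult_left_mono) auto
      then show ?thesis
        using \<psi>_le[of K "D K * ?M N"] unfolding \<phi>(2) mult.assoc by linarith
    qed
    then have "\<forall>N. norm (cdual_apply (\<phi> K) (?M N)) \<le> (inverse e * C) * inverse (real (Suc N))" ..
    from Lim_null_comparison[OF always_eventually[OF this] tendsto_times_inverse_Suc] show ?thesis .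
  qed
  ultimately show False
    using smooth_double_limit[of \<phi> ?M, OF smooth \<phi>(1) norm_ergodic_mean[OF b]] by blast
qed

lemma ergodic_limit:
  assumes p: "ergodic_mean b \<longlonglongrightarrow> p" and b: "norm b \<le> 1"
  shows "p * b = p" and "b * p = p" and "p * p = p"
proof -
  have "(\<lambda>k. ergodic_mean b k * b - ergodic_mean b k) \<longlonglongrightarrow> 0"
    by (rule Lim_null_comparison[OF always_eventually[OF allI[OF ergodic_mean_mult_diff[OF b]]]
          tendsto_times_inverse_Suc])
  moreover have "(\<lambda>k. ergodic_mean b k * b - ergodic_mean b k) \<longlonglongrightarrow> p * b - p"
    by (intro tendsto_intros p)
  ultimately show pb: "p * b = p"
    using LIMSEQ_unique by fastforce
  have "b * ergodic_mean b k = ergodic_mean b k * b" for k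
    by (simp add: ergodic_mean_def sum_distrib_left sum_distrib_right pow_Suc_commute)
  moreover have "(\<lambda>k. b * ergodic_mean b k) \<longlonglongrightarrow> b * p" "(\<lambda>k. ergodic_mean b k * b) \<longlonglongrightarrow> p * b"
    by (intro tendsto_intros p)+
  ultimately show "b * p = p"
    using pb LIMSEQ_unique by fastforce
  have "p * pow_Suc b j = p" for j
    by (induction j) (simp_all add: pb flip: mult.assoc)
  then have "p * ergodic_mean b k = p" for k
    unfolding ergodic_mean_def mult_scaleR_right sum_distrib_left by (simp add: mean_const del: sum_constant of_nat_Suc)
  moreover have "(\<lambda>k. p * ergodic_mean b k) \<longlonglongrightarrow> p * p"
    by (intro tendsto_intros p)
  ultimately have "(\<lambda>k. p) \<longlonglongrightarrow> p * p" by simp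
  from LIMSEQ_unique[OF this tendsto_const] show "p * p = p" .
qed

lemma ergodic_limit_selfadjoint:
  fixes b :: "'a::cstar_algebra"
  assumes "ergodic_mean b \<longlonglongrightarrow> p" "b\<^sup>\<star> = b"
  shows "p\<^sup>\<star> = p"
proof -
  have "(\<Sum>j\<le>k. pow_Suc b j)\<^sup>\<star> = (\<Sum>j\<le>k. pow_Suc b j)" for k
    by (induction k) (simp_all add: cstar_add cstar_mult pow_Suc_selfadjoint assms(2) pow_Suc_commute)
  then have "(\<lambda>k. ergodic_mean b k) \<longlonglongrightarrow> p\<^sup>\<star>"
    using tendsto_cstar[OF assms(1)] by (simp add: ergodic_mean_def cstar_scaleR)
  with assms(1) show ?thesis using LIMSEQ_unique by blast
qed

text \<open>\<open>1 - s\<close> is a square root of \<open>1 - e\<^sup>2\<close>, stated without the unit.\<close>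

lemma sqrt_one_minus_square:
  fixes e :: "'a::cstar_algebra"
  assumes e: "e\<^sup>\<star> = e" "norm e < 1"
  obtains s where "s\<^sup>\<star> = s" "s * e = e * s" "s + s - s * s = e * e"
proof -
  let ?S = "{s. s\<^sup>\<star> = s \<and> s * e = e * s \<and> norm s \<le> norm e}"
  \<comment> \<open>The equation \<open>s + s - s * s = e * e\<close> as a fixed-point problem. On
    the ball of radius \<open>norm e\<close> the map is Lipschitz with constant
    \<open>norm e\<close>, which is where the strict bound enters.\<close>
  let ?F = "\<lambda>s. (1 / 2) *\<^sub>R (e * e + s * s)"
  have "closed ?S"
    by (intro closed_Collect_conj closed_Collect_eq closed_Collect_le continuous_intros
        linear_continuous_on[OF bounded_linear_cstar])
  then have "complete ?S" by (simp add: complete_eq_closed)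
  moreover have "?F ` ?S \<subseteq> ?S"
  proof safe
    fix s assume s: "s\<^sup>\<star> = s" "s * e = e * s" "norm s \<le> norm e"
    show "(?F s)\<^sup>\<star> = ?F s" by (simp add: cstar_scaleR cstar_add cstar_mult e s)
    have "s * s * e = e * (s * s)" by (metis mult.assoc s(2))
    then show "?F s * e = e * ?F s" by (simp add: algebra_simps)
    have "norm (e * e + s * s) \<le> norm e + norm e"
      using norm_mult_le_of_le1(1)[of e e] norm_mult_le_of_le1(1)[of s s] e(2) s(3)
      by (intro norm_triangle_mono) auto
    then show "norm (?F s) \<le> norm e" by simp
  qed
  moreover have "dist (?F s) (?F t) \<le> norm e * dist s t" if "s \<in> ?S" "t \<in> ?S" for s t
  proof -
    have "norm (s * s - t * t) = norm (s * (s - t) + (s - t) * t)"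
      by (simp add: algebra_simps)
    also have "\<dots> \<le> norm e * norm (s - t) + norm (s - t) * norm e"
      using that by (intro norm_triangle_mono order_trans[OF norm_mult_ineq] mult_mono) auto
    finally show ?thesis
      by (simp add: dist_norm flip: scaleR_diff_right)
  qed
  moreover have "?S \<noteq> {}" by (auto intro!: exI[of _ 0])
  ultimately obtain s where s: "s \<in> ?S" "?F s = s"
    using Banach_fix[of ?S "norm e" ?F] e(2) by auto
  have "e * e + s * s = 2 *\<^sub>R ?F s" by simp
  also have "\<dots> = s + s" unfolding s(2) by (simp add: scaleR_2)
  finally have "s + s - s * s = e * e" by (simp add: algebra_simps)
  with s(1) that show ?thesis by auto
qed

text \<open>With \<open>c\<^sup>2 = 1 - e\<^sup>2\<close> the elements \<open>w\<^sub>\<plusminus> = e \<plusminus> \<i> c\<close> are unitary and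
  \<open>2 e\<^sup>2 - 1 = (w\<^sub>+\<^sup>2 + w\<^sub>-\<^sup>2) / 2\<close>.\<close>

lemma norm_double_square_minus_one_less:
  fixes e y :: "'a::cstar_algebra"
  assumes e: "e\<^sup>\<star> = e" "norm e < 1"
  shows "norm (2 *\<^sub>R (e * e * y) - y) \<le> norm y"
proof -
  obtain s where s: "s\<^sup>\<star> = s" "s * e = e * s" "s + s - s * s = e * e"
    using sqrt_one_minus_square[OF e] .
  \<comment> \<open>Left multiplication by \<open>e + \<sigma> (1 - s)\<close>, with
    \<open>\<sigma>\<close> later \<i> or its negative; the unitaries are present only as isometries
    of the algebra.\<close>
  define w where "w \<sigma> y = e * y + \<sigma> *\<^sub>C (y - s * y)" for \<sigma> y
  have iso: "norm (w \<sigma> y) = norm y" if \<sigma>: "\<sigma> * \<sigma> = - 1" "cnj \<sigma> = - \<sigma>" for \<sigma> y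
  proof -
    have one: "\<sigma> *\<^sub>C \<sigma> *\<^sub>C x = - x" for x :: 'a
      by (simp add: scaleC_scaleC \<sigma> scaleC_minus_left scaleC_one)
    have ss: "s * s = s + s - e * e" using s(3) by (simp add: algebra_simps)
    have ss': "s * (s * y) = s * y + s * y - e * (e * y)"
      by (simp add: ss algebra_simps flip: mult.assoc)
    have se: "s * (e * y) = e * (s * y)" by (simp add: s(2) flip: mult.assoc)
    have "(w \<sigma> y)\<^sup>\<star> * w \<sigma> y = (y\<^sup>\<star> * e - \<sigma> *\<^sub>C (y\<^sup>\<star> - y\<^sup>\<star> * s)) * (e * y + \<sigma> *\<^sub>C (y - s * y))"
      by (simp add: w_def cstar_add cstar_diff cstar_mult cstar_scaleC e s \<sigma> scaleC_minus_left)
    also have "\<dots> = y\<^sup>\<star> * y"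
      by (simp add: distrib_left distrib_right left_diff_distrib right_diff_distrib mult_scaleC_left
          mult_scaleC_right scaleC_diff_right scaleC_add_right one mult.assoc ss' se)
    finally have "(norm (w \<sigma> y))\<^sup>2 = (norm y)\<^sup>2"
      by (metis cstar_identity)
    then show ?thesis by simp
  qed
  have "w \<i> (w \<i> y) + w (- \<i>) (w (- \<i>) y) = 2 *\<^sub>R (2 *\<^sub>R (e * e * y) - y)"
  proof -
    have one: "\<i> *\<^sub>C \<i> *\<^sub>C x = - x" for x :: 'a
      by (simp add: scaleC_scaleC scaleC_minus_left scaleC_one)
    have ss': "s * (s * y) = s * y + s * y - e * (e * y)"
      using arg_cong[OF s(3), of "\<lambda>z. z * y"] by (simp add: algebra_simps)
    have se: "s * (e * y) = e * (s * y)" by (simp add: s(2) flip: mult.assoc)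
    show ?thesis
      by (simp add: w_def distrib_left right_diff_distrib mult_scaleC_right scaleC_diff_right scaleC_minus_right scaleC_minus_left
          scaleC_add_right one mult.assoc ss' se scaleR_2)
  qed
  then have "2 * norm (2 *\<^sub>R (e * e * y) - y) = norm (w \<i> (w \<i> y) + w (- \<i>) (w (- \<i>) y))"
    by simp
  also have "\<dots> \<le> norm y + norm y"
    by (intro norm_triangle_mono) (simp_all add: iso)
  finally show ?thesis by simp
qed

text \<open>Scaling \<open>e\<close> by n / (n + 1) makes the norm strictly less than 1, and both
  sides depend continuously on the factor.\<close>

lemma norm_double_square_minus_one:
  fixes e y :: "'a::cstar_algebra"
  assumes e: "e\<^sup>\<star> = e" "norm e \<le> 1"
  shows "norm (2 *\<^sub>R (e * e * y) - y) \<le> norm y"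
proof (rule LIMSEQ_le_const2)
  define r where "r n = real n / real (Suc n)" for n
  have r: "r \<longlonglongrightarrow> 1" unfolding r_def by (rule LIMSEQ_n_over_Suc_n)
  have "(\<lambda>n. norm (2 *\<^sub>R ((r n *\<^sub>R e) * (r n *\<^sub>R e) * y) - y))
      \<longlonglongrightarrow> norm (2 *\<^sub>R ((1 *\<^sub>R e) * (1 *\<^sub>R e) * y) - y)"
    by (intro tendsto_intros r)
  then show "(\<lambda>n. norm (2 *\<^sub>R ((r n *\<^sub>R e) * (r n *\<^sub>R e) * y) - y)) \<longlonglongrightarrow> norm (2 *\<^sub>R (e * e * y) - y)"
    by simp
  have "norm (r n *\<^sub>R e) < 1" for n
  proof -
    have "0 \<le> r n" "r n < 1" by (auto simp: r_def)
    then have "r n * norm e \<le> r n" using e(2) by (simp add: mult_left_le)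
    with \<open>r n < 1\<close> \<open>0 \<le> r n\<close> show ?thesis by simp
  qed
  then show "\<exists>N. \<forall>n\<ge>N. norm (2 *\<^sub>R ((r n *\<^sub>R e) * (r n *\<^sub>R e) * y) - y) \<le> norm y"
    by (intro exI allI impI norm_double_square_minus_one_less) (simp_all add: cstar_scaleR e)
qed

text \<open>For \<open>S = 2 e\<^sup>2 - 1\<close> the power \<open>(e\<^sup>2)\<^sup>k\<^sup>+\<^sup>1\<close> is the midpoint of \<open>(e\<^sup>2)\<^sup>k\<close> and \<open>S (e\<^sup>2)\<^sup>k\<close>, so a
  norm-one functional with value \<open>1\<close> at a high power has value \<open>1\<close> at all lower ones.\<close>

lemma norm_ergodic_mean_square:
  fixes e :: "'a::cstar_algebra"
  assumes e: "e\<^sup>\<star> = e" "norm e = 1"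
  shows "1 \<le> norm (ergodic_mean (e * e) n)"
proof -
  define t where "t = e * e"
  have t: "t\<^sup>\<star> = t" "norm t = 1"
    using norm_selfadjoint_square[OF e(1)] e by (simp_all add: t_def cstar_mult)
  obtain \<psi> where \<psi>: "norm \<psi> \<le> 1" "cdual_apply \<psi> (pow_Suc t n) = 1"
    using norming_functional[of "pow_Suc t n"] norm_pow_Suc_eq_1[OF t, of n] by auto
  have down: "cdual_apply \<psi> (pow_Suc t k) = 1" if "cdual_apply \<psi> (pow_Suc t (Suc k)) = 1" for k
  proof -
    let ?a = "cdual_apply \<psi> (pow_Suc t k)"
    have n1: "norm (pow_Suc t k) \<le> 1" using t by (simp add: norm_pow_Suc_le)
    then have "norm (2 *\<^sub>R (t * pow_Suc t k) - pow_Suc t k) \<le> 1"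
      using norm_double_square_minus_one[OF e(1), of "pow_Suc t k"] e(2) by (simp add: t_def)
    \<comment> \<open>The closed unit discs around 0 and 2 meet only in 1, which determines
      \<open>?a\<close>.\<close>
    then have "cmod (2 - ?a) \<le> 1"
      using cdual_norm_le[OF \<psi>(1)] that by (force simp: cdual_diff cdual_scaleR)
    moreover have "cmod ?a \<le> 1" using cdual_norm_le[OF \<psi>(1) n1] by simp
    ultimately have "Re ?a = 1"
      using complex_Re_le_cmod[of ?a] complex_Re_le_cmod[of "2 - ?a"] by simp
    moreover have "(Re ?a)\<^sup>2 + (Im ?a)\<^sup>2 \<le> 1"
      using power_mono[OF \<open>cmod ?a \<le> 1\<close>, of 2] by (simp add: cmod_power2)
    ultimately show ?thesis by (simp add: complex_eq_iff)
  qed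
  have one: "cdual_apply \<psi> (pow_Suc t k) = 1" if "k \<le> n" for k
    using that by (induction rule: inc_induct) (simp_all only: \<psi>(2) down)
  have "cdual_apply \<psi> (\<Sum>k\<in>A. pow_Suc t k) = (\<Sum>k\<in>A. cdual_apply \<psi> (pow_Suc t k))" for A
    by (induction A rule: infinite_finite_induct) (simp_all add: cdual_add)
  then have "cdual_apply \<psi> (ergodic_mean t n) = 1"
    by (simp add: ergodic_mean_def cdual_scaleR one field_simps del: of_nat_Suc) 
  then show ?thesis
    using cdual_norm_le[OF \<psi>(1) order_refl, of "ergodic_mean t n"] by (simp add: t_def)
qed

text \<open>The source of every spectral gap below: if \<open>e\<close> had norm 1, the means of its
  square would all have norm at least 1.\<close>

lemma ergodic_mean_square_null_imp_norm_less:
  fixes e :: "'a::cstar_algebra"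
  assumes "e\<^sup>\<star> = e" "norm e \<le> 1" "ergodic_mean (e * e) \<longlonglongrightarrow> 0"
  shows "norm e < 1"
proof (rule ccontr)
  assume "\<not> norm e < 1"
  then have "1 \<le> norm (0 :: 'a)"
    using norm_ergodic_mean_square[OF assms(1)] assms(2) tendsto_norm[OF assms(3)]
    by (intro LIMSEQ_le_const) auto
  then show False by simp
qed

section \<open>Projections\<close>

definition is_projection :: "'a::cstar_algebra \<Rightarrow> bool"
  where "is_projection p \<longleftrightarrow> p * p = p \<and> p\<^sup>\<star> = p"

text \<open>The relation \<open>s * r = s\<close> is the order of projections. The projection 0
  counts as minimal.\<close>

definition minimal_projection :: "'a::cstar_algebra \<Rightarrow> bool"
  where "minimal_projection r \<longleftrightarrow> is_projection r \<and>
    (\<forall>s. is_projection s \<longrightarrow> s * r = s \<longrightarrow> s = 0 \<or> s = r)"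

lemma norm_projection:
  assumes "is_projection p" "p \<noteq> 0"
  shows "norm p = 1"
proof -
  have "norm p * norm p = norm p"
    using norm_selfadjoint_square[of p] assms(1) by (simp add: is_projection_def power2_eq_square)
  with assms(2) show ?thesis by simp
qed

lemma norm_projection_le: "is_projection p \<Longrightarrow> norm p \<le> 1"
  using norm_projection[of p] by (cases "p = 0") auto

lemma projection_le_commute:
  assumes "is_projection p" "is_projection q" "q * p = q"
  shows "p * q = q"
  by (metis assms cstar_mult is_projection_def)

lemma projection_diff:
  assumes "is_projection p" "is_projection q" "q * p = q"
  shows "is_projection (p - q)"
  using assms projection_le_commute[OF assms]
  by (simp add: is_projection_def cstar_diff algebra_simps)

text \<open>Multiplication by 1 - p is contractive: since \<open>(z - z * p) * (z - z *
  p)\<^sup>\<star> = (z - z * p) * z\<^sup>\<star>\<close>, the C*-identity lets one factor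
  \<open>norm (z - z * p)\<close> be cancelled.\<close>

lemma norm_minus_mult_projection:
  assumes p: "is_projection p"
  shows "norm (z - z * p) \<le> norm z" and "norm (z - p * z) \<le> norm z"
proof -
  have right: "norm (z - z * p) \<le> norm z" for z
  proof (cases "z - z * p = 0")
    case False
    have "(z - z * p) * (z - z * p)\<^sup>\<star> = (z - z * p) * z\<^sup>\<star>"
    proof -
      have "z * (p * (p * w)) = z * (p * w)" for w
        by (metis p is_projection_def mult.assoc)
      then show ?thesis
        using p by (simp add: is_projection_def cstar_diff cstar_mult algebra_simps)
    qed
    then have "norm (z - z * p) * norm (z - z * p) \<le> norm (z - z * p) * norm z"
      using norm_mult_ineq[of "z - z * p" "z\<^sup>\<star>"] norm_mult_cstar[of "z - z * p"]
      by (simp add: power2_eq_square)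
    with False show ?thesis by simp
  qed simp
  show "norm (z - z * p) \<le> norm z" by (rule right)
  show "norm (z - p * z) \<le> norm z"
    using right[of "z\<^sup>\<star>"] p norm_cstar[of "z - p * z"]
    by (simp add: is_projection_def cstar_diff cstar_mult)
qed

text \<open>With the differences \<open>r k\<close>, a functional norming \<open>r k\<close> and
  compressed to the corner of \<open>r k\<close> takes the value 1 at \<open>P n\<close> for
  \<open>n \<le> k\<close> and 0 afterwards, which is the forbidden double limit.\<close>

lemma smooth_no_decreasing_projections:
  fixes P :: "nat \<Rightarrow> 'a::cstar_algebra"
  assumes smooth: "weakly_Hahn_Banach_smooth TYPE('a)"
    and P: "\<And>n. is_projection (P n)" and decr: "\<And>n. P (Suc n) * P n = P (Suc n)"
    and strict: "\<And>n. P (Suc n) \<noteq> P n"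
  shows False
proof -
  have le: "P k * P n = P k" if "n \<le> k" for n k
    using that
  proof (induction rule: dec_induct)
    case base
    show ?case using P[of n] by (simp add: is_projection_def)
  next
    case (step k)
    then show ?case by (metis decr mult.assoc)
  qed
  have ge: "P k * P n = P n" if "k \<le> n" for n k
    using projection_le_commute[OF P P le[OF that]] .
  define r where "r k = P k - P (Suc k)" for k
  have r: "is_projection (r k)" for k
    unfolding r_def by (intro projection_diff P decr)
  have r1: "norm (r k) = 1" for k
    using strict[of k] by (intro norm_projection r) (simp add: r_def)
  have rr: "r k * r k = r k" for k using r[of k] by (simp add: is_projection_def)
  have rP: "r k * P n = (if n \<le> k then r k else 0)" for k n
    by (simp add: r_def left_diff_distrib le ge)
  have "\<exists>\<phi>. norm \<phi> \<le> 1 \<and> (\<forall>n. cdual_apply \<phi> (P n) = (if n \<le> k then 1 else 0))" for k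
  proof -
    obtain \<psi> where \<psi>: "norm \<psi> \<le> 1" "cdual_apply \<psi> (r k) = 1"
      using norming_functional[of "r k"] r1[of k] by auto
    have "norm (r k * y * r k) \<le> norm y" for y
      using norm_mult_le_of_le1(1)[of "r k" y] norm_mult_le_of_le1(2)[of "r k" "r k * y"] r1[of k]
      by simp
    then have bound: "cmod (cdual_apply \<psi> (r k * y * r k)) \<le> 1 * norm y" for y
      by (rule cdual_norm_le[OF \<psi>(1)])
    obtain \<phi> where "cdual_apply \<phi> = (\<lambda>y. cdual_apply \<psi> (r k * y * r k))" "norm \<phi> \<le> 1"
      by (rule cdual_of_bounded[OF _ _ bound])
        (simp_all add: cdual_add cdual_apply_scaleC algebra_simps mult_scaleC_left mult_scaleC_right)
    then show ?thesis
      by (intro exI[of _ \<phi>]) (simp add: rP rr \<psi>(2))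
  qed
  then obtain \<phi> where \<phi>: "\<And>k. norm (\<phi> k) \<le> 1"
    "\<And>k n. cdual_apply (\<phi> k) (P n) = (if n \<le> k then 1 else 0)" by metis
  have "(\<lambda>k. cdual_apply (\<phi> k) (P n)) \<longlonglongrightarrow> 1" for n
    by (intro tendsto_eventually eventually_mono[OF eventually_ge_at_top[of n]]) (simp add: \<phi>)
  moreover have "(\<lambda>n. cdual_apply (\<phi> k) (P n)) \<longlonglongrightarrow> 0" for k
    by (intro tendsto_eventually eventually_mono[OF eventually_gt_at_top[of k]]) (simp add: \<phi>)
  ultimately show False
    using smooth_double_limit[of \<phi> P, OF smooth \<phi>(1) norm_projection_le[OF P]] by blast
qed

text \<open>The strict order of projections is well-founded. A projection \<open>r\<close> that is
  not minimal splits as \<open>s + (r - s)\<close> with both summands strictly below it.\<close>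

lemma smooth_projection_induct [consumes 2, case_names zero minimal add]:
  fixes p :: "'a::cstar_algebra"
  assumes smooth: "weakly_Hahn_Banach_smooth TYPE('a)" and p: "is_projection p"
    and zero: "Q 0" and minimal: "\<And>r :: 'a. minimal_projection r \<Longrightarrow> Q r"
    and add: "\<And>r s. Q r \<Longrightarrow> Q s \<Longrightarrow> Q (r + s)"
  shows "Q p"
proof -
  define R where "R = {(s, r :: 'a). is_projection s \<and> is_projection r \<and> s * r = s \<and> s \<noteq> r}"
  have "wf R"
    unfolding wf_iff_no_infinite_down_chain
  proof
    assume "\<exists>P. \<forall>i. (P (Suc i), P i) \<in> R"
    then obtain P where "\<And>i. (P (Suc i), P i) \<in> R" by blast
    then show False
      by (intro smooth_no_decreasing_projections[OF smooth, of P]) (auto simp: R_def)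
  qed
  then show ?thesis using p
  proof (induction p rule: wf_induct_rule)
    case (less r)
    show ?case
    proof (cases "minimal_projection r")
      case False
      then obtain s where s: "is_projection s" "s * r = s" "s \<noteq> 0" "s \<noteq> r"
        using less.prems by (auto simp: minimal_projection_def)
      have rs: "is_projection (r - s)" by (rule projection_diff[OF less.prems s(1,2)])
      have "(r - s) * r = r - s"
        using less.prems s(2) by (simp add: left_diff_distrib is_projection_def)
      then have "Q s" "Q (r - s)"
        using less.IH[of s] less.IH[of "r - s"] less.prems s rs by (auto simp: R_def)
      then have "Q (s + (r - s))" by (rule add)
      then show ?thesis by simp
    qed (rule minimal)
  qed
qed

text \<open>After normalising to \<open>a\<close> of norm 1, the limit of the means of
  \<open>a * a\<close> is a nonzero projection below \<open>r\<close>, hence \<open>r\<close>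
  itself, and this forces \<open>a * a = r\<close>.\<close>

lemma smooth_minimal_selfadjoint_corner:
  fixes r b :: "'a::cstar_algebra"
  assumes smooth: "weakly_Hahn_Banach_smooth TYPE('a)" and r: "minimal_projection r"
    and b: "b\<^sup>\<star> = b" "r * b = b" "b * r = b"
  shows "\<exists>c :: real. b = c *\<^sub>R r"
proof (cases "b = 0")
  case True
  then show ?thesis by (intro exI[of _ 0]) simp
next
  case False
  define a where "a = inverse (norm b) *\<^sub>R b"
  have ab: "b = norm b *\<^sub>R a" using False by (simp add: a_def)
  have a: "a\<^sup>\<star> = a" "norm a = 1" "r * a = a" "a * r = a"
    using False b by (simp_all add: a_def cstar_scaleR)
  have aa: "norm (a * a) = 1" "(a * a)\<^sup>\<star> = a * a"
    using norm_selfadjoint_square[OF a(1)] a by (simp_all add: cstar_mult)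
  obtain e where e: "ergodic_mean (a * a) \<longlonglongrightarrow> e"
    using smooth_ergodic_mean_convergent[OF smooth, of "a * a"] aa(1) by (auto simp: convergent_def)
  have "e \<noteq> 0"
    using ergodic_mean_square_null_imp_norm_less[of a] a e by auto
  note lim = ergodic_limit[OF e eq_refl[OF aa(1)]]
  have proj: "is_projection e"
    using lim(3) ergodic_limit_selfadjoint[OF e aa(2)] by (simp add: is_projection_def)
  have "pow_Suc (a * a) k * r = pow_Suc (a * a) k" for k
    by (induction k) (simp_all add: mult.assoc a(4))
  then have "ergodic_mean (a * a) k * r = ergodic_mean (a * a) k" for k
    by (simp add: ergodic_mean_def sum_distrib_right)
  then have "(\<lambda>k. ergodic_mean (a * a) k) \<longlonglongrightarrow> e * r"
    using tendsto_mult_right[OF e, of r] by simp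
  then have "e * r = e" using e by (rule LIMSEQ_unique)
  then have "e = r"
    using r proj \<open>e \<noteq> 0\<close> unfolding minimal_projection_def by blast
  then have "a * a = r"
    using lim(2) a(4) by (simp add: mult.assoc)
  \<comment> \<open>In the corner with unit \<open>r\<close> the element \<open>a\<close> is a
    symmetry, so \<open>u\<close> is a projection below \<open>r\<close>; its two possible values
    give \<open>a = - r\<close> and \<open>a = r\<close>.\<close>
  define u where "u = (1 / 2) *\<^sub>R (r + a)"
  have r': "r * r = r" "r\<^sup>\<star> = r"
    using r by (auto simp: minimal_projection_def is_projection_def)
  have "is_projection u" "u * r = u"
    using a(1,3,4) \<open>a * a = r\<close> r'
    by (simp_all add: u_def is_projection_def cstar_scaleR cstar_add algebra_simps flip: scaleR_add_left)
  then have "u = 0 \<or> u = r"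
    using r unfolding minimal_projection_def by blast
  moreover have "a = 2 *\<^sub>R u - r" by (simp add: u_def)
  ultimately have "a = (- 1) *\<^sub>R r \<or> a = 1 *\<^sub>R r"
    by (auto simp: scaleR_2)
  then have "b = (- norm b) *\<^sub>R r \<or> b = norm b *\<^sub>R r"
    using ab by auto
  then show ?thesis by blast
qed

text \<open>Cartesian decomposition: \<open>b + b = h + \<i> *\<^sub>C k\<close> with
  \<open>h\<close> and \<open>k\<close> self-adjoint in the corner, each a real multiple of
  \<open>r\<close>.\<close>

lemma smooth_minimal_corner:
  fixes r b :: "'a::cstar_algebra"
  assumes smooth: "weakly_Hahn_Banach_smooth TYPE('a)" and r: "minimal_projection r"
    and b: "r * b = b" "b * r = b"
  shows "\<exists>c. b = c *\<^sub>C r"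
proof -
  have r': "r\<^sup>\<star> = r"
    using r by (auto simp: minimal_projection_def is_projection_def)
  have b': "r * b\<^sup>\<star> = b\<^sup>\<star>" "b\<^sup>\<star> * r = b\<^sup>\<star>"
    using arg_cong[OF b(1), of cstar] arg_cong[OF b(2), of cstar] by (simp_all add: cstar_mult r')
  define h k where "h = b + b\<^sup>\<star>" and "k = \<i> *\<^sub>C (b\<^sup>\<star> + (- 1) *\<^sub>C b)"
  have "\<exists>c. h = c *\<^sub>R r"
    by (rule smooth_minimal_selfadjoint_corner[OF smooth r, of h])
      (simp_all add: h_def cstar_add cstar_cstar algebra_simps b b')
  then obtain c where c: "h = c *\<^sub>R r" ..
  have "\<exists>d. k = d *\<^sub>R r"
    by (rule smooth_minimal_selfadjoint_corner[OF smooth r, of k])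
      (simp_all add: k_def cstar_add cstar_cstar cstar_scaleC scaleC_add_right scaleC_scaleC
        mult_scaleC_left mult_scaleC_right algebra_simps b b')
  then obtain d where d: "k = d *\<^sub>R r" ..
  have "b + b = h + \<i> *\<^sub>C k"
    by (simp add: h_def k_def scaleC_scaleC scaleC_add_right scaleC_minus_left scaleC_one)
  also have "\<dots> = (of_real c + \<i> * of_real d) *\<^sub>C r"
    by (simp add: c d scaleC_add_left flip: scaleC_of_real scaleC_scaleC)
  finally have "(1 / 2) *\<^sub>C (b + b) = ((of_real c + \<i> * of_real d) / 2) *\<^sub>C r"
    by (simp add: scaleC_scaleC)
  moreover have "(1 / 2) *\<^sub>C (b + b) = b"
    by (simp add: scaleC_add_right scaleC_one flip: scaleC_add_left)
  ultimately show ?thesis by auto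
qed

section \<open>Finite-dimensional corners\<close>

text \<open>Purely algebraic, so that a functional composed with a left multiplication qualifies
  without being packed into \<open>cdual\<close>.\<close>

definition clinear :: "('a::complex_vector \<Rightarrow> complex) \<Rightarrow> bool"
  where "clinear h \<longleftrightarrow> (\<forall>x y. h (x + y) = h x + h y) \<and> (\<forall>c x. h (c *\<^sub>C x) = c * h x)"

text \<open>A dual formulation of \<open>r A s\<close> being finite-dimensional.\<close>

definition finite_corner :: "'a::cstar_algebra \<Rightarrow> 'a \<Rightarrow> bool"
  where "finite_corner r s \<longleftrightarrow> (\<exists>U C. finite U \<and> 0 \<le> C \<and>
    (\<forall>h m. clinear h \<longrightarrow> cmod (h (r * m * s)) \<le> C * (\<Sum>u\<in>U. cmod (h u)) * norm m))"

lemma clinear_0: "clinear h \<Longrightarrow> h 0 = 0"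
  unfolding clinear_def by (metis mult_zero_left scaleC_zero_left)

lemma finite_corner_if_zero: "(\<And>m. r * m * s = 0) \<Longrightarrow> finite_corner r s"
  unfolding finite_corner_def by (intro exI[of _ "{}"] exI[of _ 0]) (simp add: clinear_0)

lemma finite_corner_sum:
  assumes "finite_corner r s" "finite_corner r' s'"
    and split: "\<And>m. r'' * m * s'' = r * m * s + r' * m * s'"
  shows "finite_corner r'' s''"
proof -
  obtain U C where U: "finite U" "0 \<le> C"
    "\<And>h m. clinear h \<Longrightarrow> cmod (h (r * m * s)) \<le> C * (\<Sum>u\<in>U. cmod (h u)) * norm m"
    using assms(1) unfolding finite_corner_def by blast
  obtain V D where V: "finite V" "0 \<le> D"
    "\<And>h m. clinear h \<Longrightarrow> cmod (h (r' * m * s')) \<le> D * (\<Sum>u\<in>V. cmod (h u)) * norm m"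
    using assms(2) unfolding finite_corner_def by blast
  have "cmod (h (r'' * m * s'')) \<le> (C + D) * (\<Sum>u\<in>U \<union> V. cmod (h u)) * norm m" if h: "clinear h" for h m
  proof -
    have "h (r'' * m * s'') = h (r * m * s) + h (r' * m * s')"
      using h by (simp add: split clinear_def)
    then have "cmod (h (r'' * m * s'')) \<le>
        C * (\<Sum>u\<in>U. cmod (h u)) * norm m + D * (\<Sum>u\<in>V. cmod (h u)) * norm m"
      by (simp add: norm_triangle_mono U V h)
    also have "\<dots> \<le> C * (\<Sum>u\<in>U \<union> V. cmod (h u)) * norm m + D * (\<Sum>u\<in>U \<union> V. cmod (h u)) * norm m"
      using U V by (intro add_mono mult_right_mono mult_left_mono sum_mono2) auto
    finally show ?thesis by (simp add: algebra_simps)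
  qed
  then show ?thesis
    unfolding finite_corner_def using U V by (intro exI[of _ "U \<union> V"] exI[of _ "C + D"]) auto
qed

text \<open>The corner is at most one-dimensional. For a nonzero \<open>u\<close> in it,
  \<open>u * u\<^sup>\<star>\<close> is a nonzero multiple \<open>c\<close> of \<open>r\<close>, and
  for any other \<open>v\<close> in it \<open>u\<^sup>\<star> * v\<close> is a multiple
  \<open>k\<close> of \<open>s\<close>; evaluating \<open>u * u\<^sup>\<star> * v\<close> in two
  ways gives \<open>c *\<^sub>C v = k *\<^sub>C u\<close>.\<close>

lemma smooth_minimal_finite_corner:
  fixes r s :: "'a::cstar_algebra"
  assumes smooth: "weakly_Hahn_Banach_smooth TYPE('a)"
    and r: "minimal_projection r" and s: "minimal_projection s"
  shows "finite_corner r s"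
proof (cases "\<forall>m. r * m * s = 0")
  case True
  then show ?thesis by (intro finite_corner_if_zero) auto
next
  case False
  then obtain m\<^sub>0 where "r * m\<^sub>0 * s \<noteq> 0" by auto
  define u where "u = r * m\<^sub>0 * s"
  have u0: "u \<noteq> 0" by (simp add: u_def \<open>r * m\<^sub>0 * s \<noteq> 0\<close>)
  have rr: "r * r = r" "r\<^sup>\<star> = r" and ss: "s * s = s" "s\<^sup>\<star> = s"
    using r s by (auto simp: minimal_projection_def is_projection_def)
  have ru: "r * u = u" "u * s = u"
    by (simp_all add: u_def rr(1) flip: mult.assoc) (simp add: mult.assoc ss)
  have ru': "u\<^sup>\<star> * r = u\<^sup>\<star>" "s * u\<^sup>\<star> = u\<^sup>\<star>"
    using arg_cong[OF ru(1), of cstar] arg_cong[OF ru(2), of cstar] by (simp_all add: cstar_mult rr ss)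
  have "\<exists>c. u * u\<^sup>\<star> = c *\<^sub>C r"
    by (rule smooth_minimal_corner[OF smooth r, of "u * u\<^sup>\<star>"])
      (simp_all add: ru ru' mult.assoc flip: mult.assoc[of r])
  then obtain c where c: "u * u\<^sup>\<star> = c *\<^sub>C r" ..
  have "norm (u * u\<^sup>\<star>) \<noteq> 0" using u0 by (simp add: norm_mult_cstar)
  then have c0: "c \<noteq> 0" using c by auto
  have multiple: "\<exists>k. r * m * s = k *\<^sub>C u" for m
  proof -
    define v where "v = r * m * s"
    have v: "r * v = v" "v * s = v"
      by (simp_all add: v_def rr(1) flip: mult.assoc) (simp add: mult.assoc ss)
    have "\<exists>k. u\<^sup>\<star> * v = k *\<^sub>C s"
      by (rule smooth_minimal_corner[OF smooth s, of "u\<^sup>\<star> * v"])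
        (simp_all add: v ru' mult.assoc flip: mult.assoc[of s])
    then obtain k where k: "u\<^sup>\<star> * v = k *\<^sub>C s" ..
    have "c *\<^sub>C v = u * u\<^sup>\<star> * v" by (simp add: c mult_scaleC_left v)
    also have "\<dots> = k *\<^sub>C u" by (simp add: mult.assoc k mult_scaleC_right ru)
    finally have "inverse c *\<^sub>C c *\<^sub>C v = (inverse c * k) *\<^sub>C u" by (simp add: scaleC_scaleC)
    then show ?thesis using c0 by (auto simp: scaleC_scaleC scaleC_one v_def)
  qed
  have "cmod (h (r * m * s)) \<le> inverse (norm u) * (\<Sum>u\<in>{u}. cmod (h u)) * norm m" if h: "clinear h" for h m
  proof -
    obtain k where k: "r * m * s = k *\<^sub>C u" using multiple by blast
    have "norm r \<le> 1" "norm s \<le> 1"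
      using r s by (auto simp: minimal_projection_def intro: norm_projection_le)
    then have "norm (r * m * s) \<le> norm m"
      using norm_mult_le_of_le1(1)[of r m] norm_mult_le_of_le1(2)[of s "r * m"] by simp
    then have "cmod k * norm u \<le> norm m" by (simp add: k norm_scaleC)
    then have "cmod k \<le> inverse (norm u) * norm m"
      using u0 by (simp add: field_simps)
    then have "cmod k * cmod (h u) \<le> inverse (norm u) * norm m * cmod (h u)"
      by (rule mult_right_mono) simp
    moreover have "h (r * m * s) = k * h u" using h by (simp add: k clinear_def)
    ultimately show ?thesis by (simp add: norm_mult mult_ac)
  qed
  then show ?thesis
    unfolding finite_corner_def by (intro exI[of _ "{u}"] exI[of _ "inverse (norm u)"]) auto
qed

lemma smooth_finite_corner:
  fixes p q :: "'a::cstar_algebra"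
  assumes smooth: "weakly_Hahn_Banach_smooth TYPE('a)"
    and p: "is_projection p" and q: "is_projection q"
  shows "finite_corner p q"
  using smooth q
proof (induction q rule: smooth_projection_induct)
  case (minimal s)
  show ?case
    using smooth p
  proof (induction p rule: smooth_projection_induct)
    case (minimal r)
    then show ?case using \<open>minimal_projection s\<close> by (rule smooth_minimal_finite_corner[OF smooth])
  next
    case (add r r')
    then show ?case by (rule finite_corner_sum) (simp add: distrib_right)
  qed (rule finite_corner_if_zero, simp)
next
  case (add s s')
  then show ?case by (rule finite_corner_sum) (simp add: distrib_left)
qed (rule finite_corner_if_zero, simp)

section \<open>Functionals concentrated on a corner\<close>

lemma norm_add_orthogonal:
  fixes y z :: "'a::cstar_algebra"
  assumes "y * z\<^sup>\<star> = 0" "norm y \<le> 1" "norm z \<le> l"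
  shows "norm (y + z) \<le> 1 + l\<^sup>2 / 2"
proof -
  have l: "0 \<le> l" using assms(3) norm_ge_zero order_trans by blast
  have zy: "z * y\<^sup>\<star> = 0"
    by (metis assms(1) cstar_cstar cstar_mult cstar_zero)
  have "(norm (y + z))\<^sup>2 = norm (y * y\<^sup>\<star> + z * z\<^sup>\<star>)"
    by (simp add: cstar_add distrib_left distrib_right assms(1) zy flip: norm_mult_cstar)
  also have "\<dots> \<le> 1 + l\<^sup>2"
    using power_mono[OF assms(2), of 2] power_mono[OF assms(3), of 2]
    by (intro norm_triangle_mono) (simp_all add: norm_mult_cstar)
  also have "\<dots> \<le> (1 + l\<^sup>2 / 2)\<^sup>2"
    using l by (simp add: power2_eq_square algebra_simps)
  finally show ?thesis
    by (rule power2_le_imp_le) simp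
qed

text \<open>Unimodular factors make both values real and nonnegative, so they add up inside a single
  value of \<open>g\<close> at an orthogonal sum. If \<open>g y\<close> is nearly 1, little is left
  for \<open>g z\<close>.\<close>

lemma functional_orthogonal_bound:
  fixes y z :: "'a::cstar_algebra"
  assumes orth: "y * z\<^sup>\<star> = 0 \<or> y\<^sup>\<star> * z = 0"
    and "norm y \<le> 1" "norm z \<le> 1" "norm g \<le> 1" "0 \<le> l"
  shows "cmod (cdual_apply g y) + l * cmod (cdual_apply g z) \<le> 1 + l\<^sup>2 / 2"
proof -
  obtain \<mu> where \<mu>: "cmod \<mu> = 1" "\<mu> * cdual_apply g y = of_real (cmod (cdual_apply g y))"
    by (rule unimodular_rotation)
  obtain \<nu> where \<nu>: "cmod \<nu> = 1" "\<nu> * cdual_apply g z = of_real (cmod (cdual_apply g z))"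
    by (rule unimodular_rotation)
  define Y Z where "Y = \<mu> *\<^sub>C y" and "Z = (of_real l * \<nu>) *\<^sub>C z"
  have nY: "norm Y \<le> 1" and nZ: "norm Z \<le> l"
    using assms \<mu> \<nu> by (simp_all add: Y_def Z_def norm_scaleC norm_mult mult_left_le)
  have "norm (Y + Z) \<le> 1 + l\<^sup>2 / 2"
    using orth
  proof
    assume "y * z\<^sup>\<star> = 0"
    then show ?thesis
      using nY nZ by (intro norm_add_orthogonal)
        (simp_all add: Y_def Z_def cstar_scaleC mult_scaleC_left mult_scaleC_right)
  next
    assume "y\<^sup>\<star> * z = 0"
    then have "norm (Y\<^sup>\<star> + Z\<^sup>\<star>) \<le> 1 + l\<^sup>2 / 2"
      using nY nZ by (intro norm_add_orthogonal)
        (simp_all add: Y_def Z_def cstar_scaleC cstar_cstar mult_scaleC_left mult_scaleC_right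
          norm_scaleC norm_mult)
    then show ?thesis by (simp flip: cstar_add)
  qed
  then have "cmod (cdual_apply g (Y + Z)) \<le> 1 * (1 + l\<^sup>2 / 2)"
    by (rule cdual_norm_le[OF assms(4)])
  moreover have "cdual_apply g (Y + Z) =
      of_real (cmod (cdual_apply g y) + l * cmod (cdual_apply g z))"
    by (simp add: Y_def Z_def cdual_add cdual_apply_scaleC \<mu> \<nu> mult.assoc)
  ultimately show ?thesis by (simp only: norm_of_real mult_1_left)
qed

text \<open>\<open>p\<close> is the spectral projection of \<open>(x\<^sup>\<star>x)\<^sup>2\<close> at \<open>1\<close>. Multiplying the part \<open>x (1 - p)\<close>, whose norm
  is less than \<open>1\<close>, by scalars slightly larger than \<open>1\<close> does not increase the norm of \<open>x\<close>, so \<open>f\<close> vanishes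
  on it. No positivity of \<open>x\<^sup>\<star>x\<close> is used, hence \<open>x\<^sup>\<star>x p\<close> is only known to be a square root of \<open>p\<close>.\<close>

lemma smooth_norm_attaining_projections:
  fixes x :: "'a::cstar_algebra"
  assumes smooth: "weakly_Hahn_Banach_smooth TYPE('a)"
    and f: "norm f \<le> 1" and x: "norm x = 1" and fx: "cdual_apply f x = 1"
  obtains p q v m where "is_projection p" "is_projection q" "norm v \<le> 1" "norm m \<le> 1"
    "cdual_apply f v = 1" "v * p = v" "q * v = v" "\<And>z. q * z * p = v * (p * (m * z) * p)"
proof -
  define b where "b = x\<^sup>\<star> * x"
  have b: "b\<^sup>\<star> = b" "norm b = 1" "norm (b * b) = 1" "(b * b)\<^sup>\<star> = b * b"
    using cstar_identity[of x] norm_selfadjoint_square[of b] x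
    by (simp_all add: b_def cstar_mult cstar_cstar)
  obtain p where p: "ergodic_mean (b * b) \<longlonglongrightarrow> p"
    using smooth_ergodic_mean_convergent[OF smooth, of "b * b"] b(3) by (auto simp: convergent_def)
  note lim = ergodic_limit[OF p eq_refl[OF b(3)]]
  have pstar: "p\<^sup>\<star> = p" by (rule ergodic_limit_selfadjoint[OF p b(4)])
  have proj: "is_projection p" using lim(3) pstar by (simp add: is_projection_def)
  have bp: "p * b = b * p"
  proof -
    have "pow_Suc (b * b) k * b = b * pow_Suc (b * b) k" for k
      by (induction k) (simp_all add: mult.assoc)
    then have "ergodic_mean (b * b) k * b = b * ergodic_mean (b * b) k" for k
      by (simp add: ergodic_mean_def sum_distrib_left sum_distrib_right)
    then have "(\<lambda>k. ergodic_mean (b * b) k * b) \<longlonglongrightarrow> b * p"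
      using tendsto_mult_left[OF p, of b] by simp
    moreover have "(\<lambda>k. ergodic_mean (b * b) k * b) \<longlonglongrightarrow> p * b"
      by (intro tendsto_intros p)
    ultimately show ?thesis using LIMSEQ_unique by blast
  qed
  have bbp: "b * (b * p) = p" using lim(2) by (simp add: mult.assoc)
  have pp: "p * (p * y) = p * y" "b * (p * (p * y)) = b * (p * y)" for y
    using lim(3) by (simp_all flip: mult.assoc)
  have pb: "p * (b * y) = b * (p * y)" for y using bp by (simp flip: mult.assoc)
  have bbp': "b * (b * (p * y)) = p * y" for y
    using bbp by (metis mult.assoc)
  note rules = mult.assoc bbp bbp' pp pb bp lim(3)
  define d where "d = b - b * p"
  have d: "d\<^sup>\<star> = d" "norm d \<le> 1"
    using norm_minus_mult_projection(1)[OF proj, of b] b(2)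
    by (simp_all add: d_def cstar_diff cstar_mult b(1) pstar bp)
  have dd: "d * d = b * b - p"
    by (simp add: d_def left_diff_distrib right_diff_distrib rules)
  \<comment> \<open>Passing from \<open>b\<close> to \<open>d\<close> subtracts \<open>p\<close>
    from every power of the square, so the means for \<open>d * d\<close> tend to
    \<open>p - p\<close>.\<close>
  have "norm d < 1"
  proof (rule ergodic_mean_square_null_imp_norm_less[OF d])
    have ppow: "p * pow_Suc (b * b) k = p" for k
    proof (induction k)
      case 0
      show ?case by (simp add: lim(1))
    next
      case (Suc k)
      have "p * pow_Suc (b * b) (Suc k) = p * (b * b) * pow_Suc (b * b) k"
        by (simp only: pow_Suc.simps(2) mult.assoc)
      then show ?case by (simp only: lim(1) Suc)
    qed
    have "pow_Suc (d * d) k = pow_Suc (b * b) k - p" for k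
      by (induction k) (simp_all add: dd left_diff_distrib right_diff_distrib ppow rules)
    then have "pow_Suc (d * d) = (\<lambda>k. pow_Suc (b * b) k - p)" by blast
    then have "ergodic_mean (d * d) = (\<lambda>k. ergodic_mean (b * b) k - p)"
      unfolding ergodic_mean_def by (simp only: sum_subtractf scaleR_diff_right mean_const)
    then show "ergodic_mean (d * d) \<longlonglongrightarrow> 0"
      using tendsto_diff[OF p tendsto_const[of p]] by simp
  qed
  define v x' where "v = x * p" and "x' = x - v"
  define s where "s = b * p"
  have xx: "x\<^sup>\<star> * (x * y) = b * y" for y by (simp add: b_def mult.assoc)
  have s: "s\<^sup>\<star> = s" "s * s = p" "p * s = s" "s * p = s"
    by (simp_all add: s_def cstar_mult b(1) pstar rules)
  have vv: "v\<^sup>\<star> * v = s"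
    by (simp add: v_def s_def cstar_mult pstar mult.assoc xx rules)
  have vp: "v * p = v" by (simp add: v_def mult.assoc lim(3))
  have vn: "norm v \<le> 1"
    unfolding v_def using norm_mult_le_of_le1(2)[OF norm_projection_le[OF proj], of x] x by simp
  have sn: "norm s \<le> 1"
    unfolding s_def using norm_mult_le_of_le1(2)[OF norm_projection_le[OF proj], of b] b by simp
  have xx': "x'\<^sup>\<star> * x' = d" "v\<^sup>\<star> * x' = 0" "x'\<^sup>\<star> * v = 0"
    by (simp_all add: x'_def v_def d_def cstar_diff cstar_mult pstar left_diff_distrib
        right_diff_distrib mult.assoc xx rules flip: b_def)
  have sd: "s * d = 0"
    by (simp add: s_def d_def right_diff_distrib rules)
  \<comment> \<open>The square of the modulus is \<open>s + (cmod l)\<^sup>2 *\<^sub>R d\<close>, a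
    sum of two self-adjoint contractions with product 0.\<close>
  have bound: "norm (v + l *\<^sub>C x') \<le> 1" if l: "(cmod l)\<^sup>2 * norm d \<le> 1" for l
  proof -
    have "l *\<^sub>C cnj l *\<^sub>C d = (cmod l)\<^sup>2 *\<^sub>R d"
      by (simp add: scaleC_scaleC complex_norm_square[symmetric] flip: scaleC_of_real)
    then have "(v + l *\<^sub>C x')\<^sup>\<star> * (v + l *\<^sub>C x') = s + (cmod l)\<^sup>2 *\<^sub>R d"
      by (simp add: cstar_add cstar_scaleC distrib_left distrib_right mult_scaleC_left
          mult_scaleC_right vv xx')
    moreover have "norm (s + (cmod l)\<^sup>2 *\<^sub>R d) \<le> 1"
      using l by (intro norm_orthogonal_add_le_1) (simp_all add: s d cstar_scaleR sd sn)
    ultimately have "(norm (v + l *\<^sub>C x'))\<^sup>2 \<le> 1"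
      by (metis cstar_identity)
    then show ?thesis by (simp add: power_le_one_iff)
  qed
  have "cdual_apply f x' = 0"
  proof (rule ccontr)
    assume ne: "cdual_apply f x' \<noteq> 0"
    \<comment> \<open>Any \<open>R > 1\<close> with \<open>R\<^sup>2 * norm d \<le> 1\<close> would
      do; this one avoids a square root and a case split at \<open>norm d = 0\<close>, by
      \<open>4 t \<le> (1 + t)\<^sup>2\<close>.\<close>
    define R where "R = 2 / (1 + norm d)"
    have "0 < 1 + norm d" using norm_ge_zero[of d] by linarith
    then have R1: "1 < R" using \<open>norm d < 1\<close> by (simp add: R_def)
    have R2: "R\<^sup>2 * norm d \<le> 1"
    proof -
      have "4 * norm d \<le> (1 + norm d)\<^sup>2"
        using zero_le_power2[of "1 - norm d"] by (simp add: power2_eq_square algebra_simps)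
      moreover have "0 < (1 + norm d)\<^sup>2"
        using norm_ge_zero[of d] by (intro zero_less_power) linarith
      ultimately show ?thesis by (simp add: R_def power_divide field_simps)
    qed
    obtain \<mu> where \<mu>: "cmod \<mu> = 1" "\<mu> * cdual_apply f x' = of_real (cmod (cdual_apply f x'))"
      by (rule unimodular_rotation)
    have fvx: "cdual_apply f (v + x') = 1" by (simp add: x'_def fx)
    \<comment> \<open>Moves from 1 by \<open>R - 1\<close> in the direction that makes the value of
      \<open>f\<close> grow, while \<open>cmod l\<close> stays at most \<open>R\<close>.\<close>
    define l where "l = 1 + of_real (R - 1) * \<mu>"
    have "cmod l \<le> 1 + (R - 1)"
      unfolding l_def using R1 \<mu>(1) by (intro norm_triangle_mono) (simp_all add: norm_mult del: of_real_diff)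
    then have "(cmod l)\<^sup>2 * norm d \<le> R\<^sup>2 * norm d"
      by (intro mult_right_mono power_mono) auto
    then have "norm (v + l *\<^sub>C x') \<le> 1" using R2 by (intro bound) simp
    then have "cmod (cdual_apply f (v + l *\<^sub>C x')) \<le> 1 * 1" by (rule cdual_norm_le[OF f])
    moreover have "cdual_apply f (v + l *\<^sub>C x') = cdual_apply f (v + x') + (l - 1) * cdual_apply f x'"
      by (simp add: cdual_add cdual_apply_scaleC algebra_simps)
    then have "cdual_apply f (v + l *\<^sub>C x') = of_real (1 + (R - 1) * cmod (cdual_apply f x'))"
      by (simp only: fvx l_def add_diff_cancel_left' mult.assoc \<mu>(2)) simp
    ultimately have "1 + (R - 1) * cmod (cdual_apply f x') \<le> 1"
      using R1 by (simp only: norm_of_real)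
    then show False using R1 ne by (simp add: mult_le_0_iff)
  qed
  then have fv: "cdual_apply f v = 1" by (simp add: x'_def cdual_diff fx)
  \<comment> \<open>For a partial isometry this would be \<open>v * v\<^sup>\<star>\<close>. Here
    \<open>v\<^sup>\<star> * v = s\<close> with \<open>s * s = p\<close>; the inserted
    \<open>s\<close> makes \<open>q\<close> idempotent and gives \<open>q * v = v * p = v\<close>.
    The witness for \<open>m\<close> is \<open>s * v\<^sup>\<star>\<close>.\<close>
  define q where "q = v * s * v\<^sup>\<star>"
  have ss: "s * (s * y) = p * y" "p * (s * y) = s * y" "s * (p * y) = s * y" for y
    using s by (simp_all flip: mult.assoc)
  have vv': "v\<^sup>\<star> * (v * y) = s * y" for y by (simp add: vv flip: mult.assoc)
  have vp': "v * (p * y) = v * y" for y by (simp add: vp flip: mult.assoc)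
  have "is_projection q"
    by (simp add: is_projection_def q_def cstar_mult cstar_cstar s mult.assoc vv' ss)
  moreover have "q * v = v"
    by (simp add: q_def mult.assoc vv s vp)
  moreover have "norm (s * v\<^sup>\<star>) \<le> 1"
    using norm_mult_le_of_le1(1)[OF sn, of "v\<^sup>\<star>"] vn by simp
  moreover have "q * z * p = v * (p * (s * v\<^sup>\<star> * z) * p)" for z
    by (simp add: q_def mult.assoc vp')
  ultimately show ?thesis using proj vn fv vp by (intro that) auto
qed

lemma cdual_norm_le_ball:
  assumes "0 \<le> K" "\<And>z. norm z \<le> 1 \<Longrightarrow> cmod (cdual_apply h z) \<le> K"
  shows "norm h \<le> K"
proof (rule cdual_norm_leI[OF assms(1)])
  fix z
  show "cmod (cdual_apply h z) \<le> K * norm z"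
  proof (cases "z = 0")
    case False
    then have "cmod (cdual_apply h (inverse (norm z) *\<^sub>R z)) \<le> K"
      by (intro assms(2)) simp
    with False show ?thesis
      by (simp add: cdual_scaleR norm_mult norm_inverse norm_divide field_simps)
  qed simp
qed

text \<open>The error splits into \<open>z - z * p\<close> and \<open>z * p - q * (z * p)\<close>.
  The first is orthogonal to \<open>v\<close> on the right and the second on the left, and the
  hypothesis on \<open>g v\<close> bounds each contribution by \<open>l\<close>.\<close>

lemma functional_near_corner:
  fixes v z :: "'a::cstar_algebra"
  assumes p: "is_projection p" "v * p = v" and q: "is_projection q" "q * v = v"
    and v: "norm v \<le> 1" and z: "norm z \<le> 1"
    and g: "norm g \<le> 1" "cmod (cdual_apply g v - 1) \<le> l\<^sup>2 / 2" and l: "0 < l"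
  shows "cmod (cdual_apply g z - cdual_apply g (q * z * p)) \<le> 2 * l"
proof -
  have pp: "p * p = p" "p\<^sup>\<star> = p" and qq: "q * q = q" "q\<^sup>\<star> = q"
    using p q by (auto simp: is_projection_def)
  have gv: "1 - l\<^sup>2 / 2 \<le> cmod (cdual_apply g v)"
    using g(2) norm_triangle_ineq2[of 1 "1 - cdual_apply g v"] by (simp add: norm_minus_commute)
  have small: "cmod (cdual_apply g y) \<le> l" if "v * y\<^sup>\<star> = 0 \<or> v\<^sup>\<star> * y = 0" "norm y \<le> 1" for y
  proof -
    have "l * cmod (cdual_apply g y) \<le> l * l"
      using functional_orthogonal_bound[OF that(1) v that(2) g(1), of l] gv less_imp_le[OF l]
      unfolding power2_eq_square by linarith
    with l show ?thesis by simp
  qed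
  have vq: "v\<^sup>\<star> * q = v\<^sup>\<star>"
    using arg_cong[OF q(2), of cstar] by (simp add: cstar_mult qq)
  have "v * (z - z * p)\<^sup>\<star> = v * p * z\<^sup>\<star> - v * p * p * z\<^sup>\<star>"
    by (simp add: p(2) pp cstar_diff cstar_mult right_diff_distrib mult.assoc flip: mult.assoc[of v p])
  then have 1: "cmod (cdual_apply g (z - z * p)) \<le> l"
    using norm_minus_mult_projection(1)[OF p(1), of z] z by (intro small) (simp_all add: p(2))
  have "norm (z * p) \<le> 1"
    using norm_mult_le_of_le1(2)[OF norm_projection_le[OF p(1)], of z] z by simp
  then have 2: "cmod (cdual_apply g (z * p - q * (z * p))) \<le> l"
    using norm_minus_mult_projection(2)[OF q(1), of "z * p"]
    by (intro small) (simp_all add: right_diff_distrib vq flip: mult.assoc)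
  have "cdual_apply g z - cdual_apply g (q * z * p) =
      cdual_apply g (z - z * p) + cdual_apply g (z * p - q * (z * p))"
    by (simp add: cdual_diff mult.assoc)
  then show ?thesis using norm_triangle_mono[OF 1 2] by simp
qed

lemma smooth_imp_weak_Namioka_Phelps:
  assumes smooth: "weakly_Hahn_Banach_smooth TYPE('a::cstar_algebra)"
  shows "weak_Namioka_Phelps TYPE('a)"
proof (rule weak_Namioka_PhelpsI)
  fix f :: "'a cdual" and x e
  assume f: "norm f = 1" and x: "norm x = 1" "cdual_apply f x = 1" and e: "(0 :: real) < e"
  obtain p q v m where p: "is_projection p" and q: "is_projection q"
    and v: "norm v \<le> 1" and m: "norm m \<le> 1" and fv: "cdual_apply f v = 1"
    and vp: "v * p = v" and qv: "q * v = v"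
    and corner: "\<And>z. q * z * p = v * (p * (m * z) * p)"
    using smooth_norm_attaining_projections[OF smooth eq_refl[OF f] x] by metis
  obtain U C where U: "finite U" "0 \<le> C"
    "\<And>h z. clinear h \<Longrightarrow> cmod (h (p * z * p)) \<le> C * (\<Sum>u\<in>U. cmod (h u)) * norm z"
    using smooth_finite_corner[OF smooth p p] unfolding finite_corner_def by blast
  \<comment> \<open>Cutting down to the corner costs \<open>2 * l\<close> for each of
    \<open>f\<close> and \<open>g\<close>, so \<open>e / 2\<close> in total, and the corner itself
    costs \<open>e / 4\<close>. The \<open>+ 1\<close> keeps the denominator positive.\<close>
  define l \<eta> where "l = e / 8" and "\<eta> = min (l\<^sup>2 / 2) (e / (4 * (C * card U + 1)))"
  have l: "0 < l" using e by (simp add: l_def)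
  have C1: "0 < C * card U + 1" using U(2) by (simp add: add_nonneg_pos)
  have \<eta>: "0 < \<eta>" "\<eta> \<le> l\<^sup>2 / 2"
    using l e C1 unfolding \<eta>_def by (simp_all only: min_less_iff_conj min.cobounded1) simp
  have "(C * card U) * \<eta> \<le> (C * card U) * (e / (4 * (C * card U + 1)))"
    using U(2) by (intro mult_left_mono) (auto simp: \<eta>_def)
  also have "\<dots> \<le> e / 4"
    using C1 e by (simp add: field_simps)
  finally have C\<eta>: "C * card U * \<eta> \<le> e / 4" .
  \<comment> \<open>The tests are at \<open>v * u\<close> because the corner is reached as
    \<open>v\<close> times elements of the corner of \<open>p\<close>. Including \<open>p\<close>
    tests \<open>v * p = v\<close> itself, where \<open>f\<close> equals 1.\<close>
  define V where "V = (\<Inter>u\<in>insert p U. {g. cdual_apply g (v * u) \<in> ball (cdual_apply f (v * u)) \<eta>})"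
  show "\<exists>V. openin weak_star_topology V \<and> f \<in> V \<and> (\<forall>g\<in>V. norm g = 1 \<longrightarrow> norm (g - f) < e)"
  proof (intro exI[of _ V] conjI ballI impI)
    show "openin weak_star_topology V"
      unfolding V_def using U(1) by (intro openin_INT2 weak_star_openI) auto
    show "f \<in> V" using \<eta>(1) by (simp add: V_def)
    fix g assume gV: "g \<in> V" and g: "norm g = 1"
    have near: "cmod (cdual_apply (g - f) (v * u)) \<le> \<eta>" if "u \<in> insert p U" for u
      using gV that by (auto simp: V_def dist_norm norm_minus_commute minus_cdual.rep_eq)
    have gv: "cmod (cdual_apply g v - 1) \<le> l\<^sup>2 / 2"
      using near[of p] \<eta>(2) by (simp add: vp minus_cdual.rep_eq fv)
    have "norm (g - f) \<le> 3 * e / 4"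
    proof (rule cdual_norm_le_ball)
      fix z :: 'a assume z: "norm z \<le> 1"
      let ?h = "\<lambda>y. cdual_apply (g - f) (v * y)"
      have "clinear ?h"
        by (simp add: clinear_def distrib_left cdual_add mult_scaleC_right cdual_apply_scaleC)
      then have "cmod (?h (p * (m * z) * p)) \<le> C * (\<Sum>u\<in>U. cmod (?h u)) * norm (m * z)"
        by (rule U(3))
      also have "\<dots> \<le> C * (card U * \<eta>) * 1"
        using U(2) near sum_bounded_above[of U "\<lambda>u. cmod (?h u)" \<eta>] \<eta>(1)
          norm_mult_le_of_le1(1)[OF m, of z] z
        by (intro mult_mono mult_left_mono mult_nonneg_nonneg sum_nonneg) auto
      finally have 1: "cmod (cdual_apply (g - f) (q * z * p)) \<le> e / 4"
        using C\<eta> by (simp only: corner mult_1_right mult.assoc[of C])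
      have 2: "cmod (cdual_apply g z - cdual_apply g (q * z * p)) \<le> 2 * l"
        by (rule functional_near_corner[OF p vp q qv v z eq_refl[OF g] gv l])
      have 3: "cmod (cdual_apply f z - cdual_apply f (q * z * p)) \<le> 2 * l"
        by (rule functional_near_corner[OF p vp q qv v z eq_refl[OF f] _ l]) (simp add: fv)
      have "cdual_apply (g - f) z = cdual_apply (g - f) (q * z * p) +
          ((cdual_apply g z - cdual_apply g (q * z * p)) - (cdual_apply f z - cdual_apply f (q * z * p)))"
        by (simp add: minus_cdual.rep_eq)
      then have "cmod (cdual_apply (g - f) z) \<le> e / 4 + (2 * l + 2 * l)"
        using norm_triangle_mono[OF 1 order_trans[OF norm_triangle_ineq4 add_mono[OF 2 3]]] by simp
      then show "cmod (cdual_apply (g - f) z) \<le> 3 * e / 4" by (simp add: l_def)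
    qed (use e in simp)
    then show "norm (g - f) < e" using e by simp
  qed
qed

theorem theorem4:
  shows "weakly_Hahn_Banach_smooth TYPE('a::cstar_algebra) \<longleftrightarrow> weak_Namioka_Phelps TYPE('a)"
  using smooth_imp_weak_Namioka_Phelps weak_Namioka_Phelps_imp_smooth by blast

end
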